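(* Let $\mathcal P$ and $\mathcal Q$ be chiral or directly regular polyhedra. Then $\mathcal P \diamond \mathcal Q$ is a chiral or directly regular polyhedron.
   Context: An abstract polytope of rank $n$ (an $n$-polytope; a polyhedron is a $3$-polytope) is a ranked poset of faces with ranks from $-1$ to $n$, with a unique least face (rank $-1$) and a unique greatest face (rank $n$), in which every flag (maximal chain) has $n+2$ faces, which satisfies the diamond condition (whenever $F<G$ with ranks $j-1$ and $j+1$ there are exactly two $j$-faces strictly between them), and which is strongly flag-connected (any two flags $\Phi,\Psi$ are joined by a sequence of flags, consecutive ones adjacent, all containing $\Phi\cap\Psi$; two flags are adjacent if they differ in exactly one face). $\Phi^j$ denotes the unique flag differing from $\Phi$ only in its $j$-face, and $\Phi^{i,j}=(\Phi^i)^j$. Each polytope considered has a fixed base flag $\Phi$. $\mathcal P$ is regular if its automorphism group $\Gamma(\mathcal P)$ is transitive on flags; then $\Gamma(\mathcal P)$ is generated by $\rho_0,\dots,\rho_{n-1}$, where $\rho_i$ maps $\Phi$ to $\Phi^i$. Put $\sigma_i=\rho_{i-1}\rho_i$ and $\Gamma^+(\mathcal P)=\langle\sigma_1,\dots,\sigma_{n-1}\rangle$; $\mathcal P$ is directly regular if it is regular and $\Gamma^+(\mathcal P)$ has index $2$ in $\Gamma(\mathcal P)$. $\mathcal P$ is chiral if $\Gamma(\mathcal P)$ has exactly two orbits on flags and adjacent flags lie in distinct orbits; then $\Gamma^+(\mathcal P):=\Gamma(\mathcal P)$ is generated by $\sigma_1,\dots,\sigma_{n-1}$, where $\sigma_i$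 maps $\Phi$ to $\Phi^{i,i-1}$. In both cases $(\sigma_i\cdots\sigma_j)^2=1$ for $i<j$. Intersection property: for a group $G$ with specified generators $\sigma_1,\dots,\sigma_{n-1}$, put $\tau_{i,j}=\sigma_i\cdots\sigma_j$ ($1\le i\le j\le n-1$) and, for $I\subseteq\{0,\dots,n-1\}$, $G_I=\langle\tau_{i,j}\mid i\le j,\ i-1,j\in I\rangle$. $G$ has the intersection property if $G_I\cap G_J=G_{I\cap J}$ for all $I,J\subseteq\{0,\dots,n-1\}$. Known facts: rotation groups $\Gamma^+(\mathcal P)$ of chiral or directly regular $n$-polytopes have the intersection property; conversely, a group generated by $\sigma_1,\dots,\sigma_{n-1}$ with $(\sigma_i\cdots\sigma_j)^2=1$ for $i<j$ and with the intersection property is the rotation group of a chiral or directly regular $n$-polytope. For $n=3$ the intersection property amounts to $\langle\sigma_1\rangle\cap\langle\sigma_2\rangle=\{1\}$. Mix: for $\Gamma^+(\mathcal P)=\langle\sigma_1,\dots,\sigma_{n-1}\rangle$ and $\Gamma^+(\mathcal Q)=\langle\sigma_1',\dots,\sigma_{n-1}'\rangle$, the mix $\Gamma^+(\mathcal P)\diamond\Gamma^+(\mathcal Q)$ is the subgroup of the direct product generated by $\beta_i=(\sigma_i,\sigma_i')$. $\mathcal P\diamond\mathcal Q$ denotes the chiral or directly regular flag-connected pre-polytope (i.e. polytope axioms with strong flag-connectedness weakened to flag-connectedness) built from this group with generators $\beta_1,\dots,\beta_{n-1}$, so $\Gamma^+(\mathcal P\diamond\mathcal Q)=\Gamma^+(\mathcal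 P)\diamond\Gamma^+(\mathcal Q)$; it is a polytope if and only if this group, with generators $\beta_i$, has the intersection property, in which case it is the chiral or directly regular $n$-polytope with this rotation group. *)

theory Defs
  imports
    "HOL-Algebra.Bij"
    "HOL-Algebra.Coset"
    "HOL-Algebra.Generated_Groups"
    "HOL-Algebra.Group_Action"
begin

section \<open>Abstract polytopes with a base flag\<close>

record 'a based_poset =
  faces :: "'a set"
  le :: "'a rel"
  rank :: "'a \<Rightarrow> int"
  base :: "'a set"

definition flags :: "'a based_poset \<Rightarrow> 'a set set" where
  "flags P = {\<Phi> \<in> Chains (le P). \<forall>C \<in> Chains (le P). \<Phi> \<subseteq> C \<longrightarrow> C = \<Phi>}"

definition adjacent :: "'a set \<Rightarrow> 'a set \<Rightarrow> bool" where
  "adjacent \<Phi> \<Psi> \<longleftrightarrow> card (\<Phi> - \<Psi>) = 1 \<and> card (\<Psi> - \<Phi>) = 1"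

definition strictly_below :: "'a based_poset \<Rightarrow> 'a \<Rightarrow> 'a \<Rightarrow> bool" where
  "strictly_below P F G \<longleftrightarrow> (F, G) \<in> le P \<and> F \<noteq> G"

definition ranked_poset :: "nat \<Rightarrow> 'a based_poset \<Rightarrow> bool" where
  "ranked_poset n P \<longleftrightarrow>
     partial_order_on (faces P) (le P) \<and>
     (\<forall>F \<in> faces P. rank P F \<in> {-1..int n}) \<and>
     (\<forall>F G. strictly_below P F G \<longrightarrow> rank P F < rank P G)"

definition diamond_condition :: "'a based_poset \<Rightarrow> bool" where
  "diamond_condition P \<longleftrightarrow>
     (\<forall>F G j. strictly_below P F G \<and> rank P F = j - 1 \<and> rank P G = j + 1 \<longrightarrow>
        card {H \<in> faces P. rank P H = j \<and> strictly_below P F H \<and> strictly_below P H G} = 2)"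

definition strongly_flag_connected :: "'a based_poset \<Rightarrow> bool" where
  "strongly_flag_connected P \<longleftrightarrow>
     (\<forall>\<Phi> \<in> flags P. \<forall>\<Psi> \<in> flags P.
        (\<Phi>, \<Psi>) \<in> {(\<Lambda>, \<Lambda>'). \<Lambda> \<in> flags P \<and> \<Lambda>' \<in> flags P \<and> adjacent \<Lambda> \<Lambda>' \<and>
                             \<Phi> \<inter> \<Psi> \<subseteq> \<Lambda> \<and> \<Phi> \<inter> \<Psi> \<subseteq> \<Lambda>'}\<^sup>*)"

definition abstract_polytope :: "nat \<Rightarrow> 'a based_poset \<Rightarrow> bool" where
  "abstract_polytope n P \<longleftrightarrow>
     ranked_poset n P \<and>
     (\<exists>L \<in> faces P. rank P L = -1 \<and> (\<forall>F \<in> faces P. (L, F) \<in> le P)) \<and>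
     (\<exists>T \<in> faces P. rank P T = int n \<and> (\<forall>F \<in> faces P. (F, T) \<in> le P)) \<and>
     (\<forall>\<Phi> \<in> flags P. card \<Phi> = n + 2) \<and>
     diamond_condition P \<and>
     strongly_flag_connected P \<and>
     base P \<in> flags P"

text \<open>\<open>flag_nbr P \<Phi> j\<close> is \<open>\<Phi>\<^sup>j\<close>.\<close>

definition flag_nbr :: "'a based_poset \<Rightarrow> 'a set \<Rightarrow> int \<Rightarrow> 'a set" where
  "flag_nbr P \<Phi> j =
     (THE \<Psi>. \<Psi> \<in> flags P \<and> \<Psi> \<noteq> \<Phi> \<and> (\<forall>F. rank P F \<noteq> j \<longrightarrow> (F \<in> \<Psi> \<longleftrightarrow> F \<in> \<Phi>)))"


section \<open>Automorphisms, regularity and chirality\<close>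

text \<open>Automorphisms act on the right, so in a product the left factor is applied first; this is
  the convention under which \<open>\<rho>\<^sub>i\<^sub>-\<^sub>1 \<rho>\<^sub>i\<close> maps the base flag \<open>\<Phi>\<close> to \<open>\<Phi>\<^sup>i\<^sup>,\<^sup>i\<^sup>-\<^sup>1\<close>.\<close>

definition aut_group :: "'a based_poset \<Rightarrow> ('a \<Rightarrow> 'a) monoid" where
  "aut_group P =
     \<lparr>carrier = {\<gamma> \<in> Bij (faces P).
        \<forall>F \<in> faces P. \<forall>G \<in> faces P. (F, G) \<in> le P \<longleftrightarrow> (\<gamma> F, \<gamma> G) \<in> le P},
      mult = \<lambda>\<gamma> \<delta>. compose (faces P) \<delta> \<gamma>,
      one = \<lambda>F \<in> faces P. F\<rparr>"

definition flag_transitive :: "'a based_poset \<Rightarrow> bool" where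
  "flag_transitive P \<longleftrightarrow>
     (\<forall>\<Phi> \<in> flags P. \<forall>\<Psi> \<in> flags P. \<exists>\<gamma> \<in> carrier (aut_group P). \<gamma> ` \<Phi> = \<Psi>)"

definition regular :: "nat \<Rightarrow> 'a based_poset \<Rightarrow> bool" where
  "regular n P \<longleftrightarrow> abstract_polytope n P \<and> flag_transitive P"

text \<open>\<open>refl_gen P i\<close> is \<open>\<rho>\<^sub>i\<close> and \<open>rot_gen P i\<close> is \<open>\<sigma>\<^sub>i\<close>; the second branch of \<open>rot_gen\<close>
  is the one for chiral polytopes.\<close>

definition refl_gen :: "'a based_poset \<Rightarrow> int \<Rightarrow> 'a \<Rightarrow> 'a" where
  "refl_gen P i =
     (THE \<gamma>. \<gamma> \<in> carrier (aut_group P) \<and> \<gamma> ` base P = flag_nbr P (base P) i)"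

definition rot_gen :: "'a based_poset \<Rightarrow> int \<Rightarrow> 'a \<Rightarrow> 'a" where
  "rot_gen P i =
     (if flag_transitive P then refl_gen P (i - 1) \<otimes>\<^bsub>aut_group P\<^esub> refl_gen P i
      else THE \<gamma>. \<gamma> \<in> carrier (aut_group P) \<and>
                  \<gamma> ` base P = flag_nbr P (flag_nbr P (base P) i) (i - 1))"

definition rotation_group :: "nat \<Rightarrow> 'a based_poset \<Rightarrow> ('a \<Rightarrow> 'a) monoid" where
  "rotation_group n P =
     (if flag_transitive P then subgroup_generated (aut_group P) (rot_gen P ` {1..int n - 1})
      else aut_group P)"

definition directly_regular :: "nat \<Rightarrow> 'a based_poset \<Rightarrow> bool" where
  "directly_regular n P \<longleftrightarrow>
     regular n P \<and> card (rcosets\<^bsub>aut_group P\<^esub> carrier (rotation_group n P)) = 2"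

definition chiral :: "nat \<Rightarrow> 'a based_poset \<Rightarrow> bool" where
  "chiral n P \<longleftrightarrow>
     abstract_polytope n P \<and>
     card (orbits (aut_group P) (flags P) (`)) = 2 \<and>
     (\<forall>\<Phi> \<in> flags P. \<forall>\<Psi> \<in> flags P. adjacent \<Phi> \<Psi> \<longrightarrow>
        orbit (aut_group P) (`) \<Phi> \<noteq> orbit (aut_group P) (`) \<Psi>)"


section \<open>The poset of a group with specified generators\<close>

definition tau :: "('g, 'm) monoid_scheme \<Rightarrow> (int \<Rightarrow> 'g) \<Rightarrow> int \<Rightarrow> int \<Rightarrow> 'g" where
  "tau G \<sigma> i j = foldr (mult G) (map \<sigma> [i..j]) \<one>\<^bsub>G\<^esub>"

definition gen_subgroup :: "('g, 'm) monoid_scheme \<Rightarrow> (int \<Rightarrow> 'g) \<Rightarrow> int set \<Rightarrow> 'g set" where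
  "gen_subgroup G \<sigma> I = generate G {tau G \<sigma> i j | i j. i \<le> j \<and> i - 1 \<in> I \<and> j \<in> I}"

text \<open>The stabiliser of the base \<open>j\<close>-face is the subgroup \<open>G\<^sub>I\<close> with \<open>I = {0,\<dots>,n-1} - {j}\<close>, i.e.
  \<open>\<langle>\<sigma>\<^sub>i (i \<noteq> j, j+1), \<sigma>\<^sub>j\<sigma>\<^sub>j\<^sub>+\<^sub>1\<rangle>\<close> for \<open>0 < j < n-1\<close>; for \<open>j = -1\<close> and \<open>j = n\<close> it is the whole group,
  which gives the two improper faces.\<close>

definition face_subgroup :: "nat \<Rightarrow> ('g, 'm) monoid_scheme \<Rightarrow> (int \<Rightarrow> 'g) \<Rightarrow> int \<Rightarrow> 'g set" where
  "face_subgroup n G \<sigma> j = gen_subgroup G \<sigma> ({0..int n - 1} - {j})"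

text \<open>The Schulte--Weiss construction: \<open>j\<close>-faces are the right cosets of the \<open>j\<close>-th face subgroup,
  tagged with their rank, and faces are incident iff the cosets meet.\<close>

definition coset_faces ::
  "nat \<Rightarrow> ('g, 'm) monoid_scheme \<Rightarrow> (int \<Rightarrow> 'g) \<Rightarrow> (int \<times> 'g set) set" where
  "coset_faces n G \<sigma> = (SIGMA j : {-1..int n}. rcosets\<^bsub>G\<^esub> face_subgroup n G \<sigma> j)"

definition coset_poset ::
  "nat \<Rightarrow> ('g, 'm) monoid_scheme \<Rightarrow> (int \<Rightarrow> 'g) \<Rightarrow> (int \<times> 'g set) based_poset" where
  "coset_poset n G \<sigma> =
     \<lparr>faces = coset_faces n G \<sigma>,
      le = {((i, C), (j, D)). (i, C) \<in> coset_faces n G \<sigma> \<and> (j, D) \<in> coset_faces n G \<sigma> \<and>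
                              i \<le> j \<and> C \<inter> D \<noteq> {}},
      rank = fst,
      base = (\<lambda>j. (j, face_subgroup n G \<sigma> j)) ` {-1..int n}\<rparr>"


section \<open>The mix\<close>

definition mix_gen ::
  "'a based_poset \<Rightarrow> 'b based_poset \<Rightarrow> int \<Rightarrow> ('a \<Rightarrow> 'a) \<times> ('b \<Rightarrow> 'b)" where
  "mix_gen P Q i = (rot_gen P i, rot_gen Q i)"

definition mix_group ::
  "nat \<Rightarrow> 'a based_poset \<Rightarrow> 'b based_poset \<Rightarrow> (('a \<Rightarrow> 'a) \<times> ('b \<Rightarrow> 'b)) monoid" where
  "mix_group n P Q =
     subgroup_generated (rotation_group n P \<times>\<times> rotation_group n Q) (mix_gen P Q ` {1..int n - 1})"

definition mix ::
  "nat \<Rightarrow> 'a based_poset \<Rightarrow> 'b based_poset \<Rightarrow>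
     (int \<times> (('a \<Rightarrow> 'a) \<times> ('b \<Rightarrow> 'b)) set) based_poset" where
  "mix n P Q = coset_poset n (mix_group n P Q) (mix_gen P Q)"

end

theory Submission
  imports Defs
begin

text \<open>The intersection property for rank 3 says \<open>\<langle>\<sigma>\<^sub>1\<rangle> \<inter> \<langle>\<sigma>\<^sub>2\<rangle> = 1\<close>: a rotation in both subgroups fixes the
  base vertex and the base 2-face, so it maps the base flag to itself or to its 1-adjacent flag, and
  the latter is impossible for a rotation. The property passes to the mix coordinatewise.
  Conversely, in the coset poset of a group with \<open>(\<sigma>\<^sub>1 \<sigma>\<^sub>2)\<^sup>2 = 1\<close> and \<open>\<langle>\<sigma>\<^sub>1\<rangle> \<inter> \<langle>\<sigma>\<^sub>2\<rangle> = 1\<close>, every flag is either the set of faces through a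
  group element or 1-adjacent to one; adjacency switches between the two kinds, and right
  multiplication is simply transitive on each kind. So the poset is directly regular if some
  automorphism exchanges the two kinds, and chiral otherwise.\<close>

section \<open>Flags of bounded posets of rank 3\<close>

text \<open>In rank 3 the group to be compared with is trivial, so the intersection condition can be
  checked in each factor separately. In higher rank it may be nontrivial, and a pair whose
  coordinates lie in the two factor subgroups need not lie in the subgroup generated by the paired
  generators. Besides the intersection, both generators must be nontrivial: otherwise some intervals
  of the coset poset have fewer than two middle faces. Chiral and directly regular polyhedra are
  treated together, because in both cases \<open>rot_gen P i\<close> sends the base flag to the
  (i-1)-neighbour of its i-neighbour. The shape of flags is worked out from the order and rank
  axioms alone, so that it is available for the coset poset before that poset is known to be a
  polytope.\<close>

locale ranked_poset3 =
  fixes P :: "'a based_poset" and L T :: 'a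
  assumes ranked: "ranked_poset 3 P"
    and least: "L \<in> faces P" "rank P L = -1" "\<And>F. F \<in> faces P \<Longrightarrow> (L, F) \<in> le P"
    and greatest: "T \<in> faces P" "rank P T = 3" "\<And>F. F \<in> faces P \<Longrightarrow> (F, T) \<in> le P"
begin

lemma le_in_faces:
  assumes "(F, G) \<in> le P"
  shows "F \<in> faces P" "G \<in> faces P"
  using assms ranked by (auto simp: ranked_poset_def partial_order_on_def preorder_on_def)

lemma le_refl: "F \<in> faces P \<Longrightarrow> (F, F) \<in> le P"
  using ranked by (auto simp: ranked_poset_def partial_order_on_def preorder_on_def refl_on_def)

lemma le_trans: "(F, G) \<in> le P \<Longrightarrow> (G, H) \<in> le P \<Longrightarrow> (F, H) \<in> le P"
  using ranked unfolding ranked_poset_def partial_order_on_def preorder_on_def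
  by (meson transD)

lemma rank_less: "(F, G) \<in> le P \<Longrightarrow> F \<noteq> G \<Longrightarrow> rank P F < rank P G"
  using ranked by (auto simp: ranked_poset_def strictly_below_def)

lemma le_antisym: "(F, G) \<in> le P \<Longrightarrow> (G, F) \<in> le P \<Longrightarrow> F = G"
  using rank_less[of F G] rank_less[of G F] by force

lemma rank_range: "F \<in> faces P \<Longrightarrow> rank P F \<in> {-1..3}"
  using ranked by (auto simp: ranked_poset_def)

lemma chain_subset_faces: "C \<in> Chains (le P) \<Longrightarrow> C \<subseteq> faces P"
  by (auto simp: Chains_def dest: le_in_faces)

lemma chain_rank_inj: "C \<in> Chains (le P) \<Longrightarrow> inj_on (rank P) C"
  unfolding inj_on_def Chains_def by (metis (mono_tags, lifting) mem_Collect_eq order_less_irrefl rank_less)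

text \<open>The rank embeds a chain into the five values -1 to 3. The bound 5 later makes every
  five-element chain maximal.\<close>

lemma chain_card:
  assumes "C \<in> Chains (le P)"
  shows "finite C" "card C \<le> 5"
proof -
  have sub: "rank P ` C \<subseteq> {-1..3}"
    using chain_subset_faces[OF assms] rank_range by blast
  show "finite C"
    using chain_rank_inj[OF assms] sub finite_imageD finite_subset by blast
  show "card C \<le> 5"
    using card_inj_on_le[OF chain_rank_inj[OF assms] sub] by simp
qed

text \<open>Only the incidences through the middle face are recorded; the one between
  \<open>a\<close> and \<open>c\<close> follows by transitivity. Hence vertex and 2-face can be
  exchanged independently once the edge is fixed.\<close>

definition triple :: "'a \<Rightarrow> 'a \<Rightarrow> 'a \<Rightarrow> bool" where
  "triple a b c \<longleftrightarrow> rank P a = 0 \<and> rank P b = 1 \<and> rank P c = 2 \<and> (a, b) \<in> le P \<and> (b, c) \<in> le P"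

definition flag :: "'a \<Rightarrow> 'a \<Rightarrow> 'a \<Rightarrow> 'a set" where
  "flag a b c = {L, a, b, c, T}"

lemma triple_faces:
  assumes "triple a b c"
  shows "a \<in> faces P" "b \<in> faces P" "c \<in> faces P" "(a, c) \<in> le P"
  using assms le_in_faces le_trans unfolding triple_def by blast+

lemma card_flag:
  assumes "triple a b c"
  shows "card (flag a b c) = 5"
proof -
  have "distinct (map (rank P) [L, a, b, c, T])"
    using assms least(2) greatest(2) by (simp add: triple_def)
  then have "distinct [L, a, b, c, T]"
    unfolding distinct_map by blast
  then have "card (set [L, a, b, c, T]) = 5"
    by (subst distinct_card) auto
  then show ?thesis
    by (simp add: flag_def)
qed

lemma flag_in_flags:
  assumes "triple a b c"
  shows "flag a b c \<in> flags P"
proof -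
  note t = assms[unfolded triple_def] triple_faces[OF assms]
  have ch: "flag a b c \<in> Chains (le P)"
    using t least greatest le_refl unfolding Chains_def flag_def by auto
  have "C = flag a b c" if "C \<in> Chains (le P)" "flag a b c \<subseteq> C" for C
    using chain_card[OF that(1)] card_flag[OF assms] that(2)
    by (metis card_seteq)
  then show ?thesis
    using ch by (auto simp: flags_def)
qed

text \<open>Recording the rank of each member lets flags be compared rank by rank, the form in which
  \<open>flag_nbr\<close> is defined.\<close>

lemma mem_flag_rank:
  assumes "triple a b c"
  shows "F \<in> flag a b c \<longleftrightarrow>
    F = L \<and> rank P F = -1 \<or> F = a \<and> rank P F = 0 \<or> F = b \<and> rank P F = 1 \<or>
    F = c \<and> rank P F = 2 \<or> F = T \<and> rank P F = 3"
  using assms least(2) greatest(2) by (auto simp: flag_def triple_def)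

lemma flag_eq_iff:
  assumes "triple a b c" "triple a' b' c'"
  shows "flag a b c = flag a' b' c' \<longleftrightarrow> a = a' \<and> b = b' \<and> c = c'"
proof
  assume eq: "flag a b c = flag a' b' c'"
  have "a \<in> flag a b c" "b \<in> flag a b c" "c \<in> flag a b c"
    by (auto simp: flag_def)
  then show "a = a' \<and> b = b' \<and> c = c'"
    using assms unfolding eq mem_flag_rank[OF assms(2)] triple_def by auto
qed auto

text \<open>An injective rank map from five elements to five values is onto, so every rank occurs.
  The members of rank -1 and 3 must be \<open>L\<close> and \<open>T\<close>, because distinct
  comparable faces have different ranks.\<close>

lemma chain_card_5_cases:
  assumes "\<Phi> \<in> Chains (le P)" "card \<Phi> = 5"
  obtains a b c where "triple a b c" "\<Phi> = flag a b c"
proof -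
  have sub: "rank P ` \<Phi> \<subseteq> {-1..3}"
    using chain_subset_faces[OF assms(1)] rank_range by blast
  have "card (rank P ` \<Phi>) = card {-1..3::int}"
    using card_image[OF chain_rank_inj[OF assms(1)]] assms(2) by simp
  then have im: "rank P ` \<Phi> = {-1..3}"
    using sub by (intro card_subset_eq) auto
  have ex: "\<exists>F \<in> \<Phi>. rank P F = j" if "j \<in> {-1..3}" for j
    using that im by (metis imageE)
  obtain a b c where abc: "a \<in> \<Phi>" "b \<in> \<Phi>" "c \<in> \<Phi>" "rank P a = 0" "rank P b = 1" "rank P c = 2"
    using ex[of 0] ex[of 1] ex[of 2] by auto
  have "(F, G) \<in> le P" if "F \<in> \<Phi>" "G \<in> \<Phi>" "rank P F < rank P G" for F G
    using assms(1) that rank_less[of G F] unfolding Chains_def by fastforce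
  then have t: "triple a b c"
    using abc by (auto simp: triple_def)
  have "L \<in> \<Phi>"
  proof -
    obtain F where F: "F \<in> \<Phi>" "rank P F = -1"
      using ex[of "-1"] by auto
    then have "F = L"
      using rank_less[of L F] least chain_subset_faces[OF assms(1)] by fastforce
    then show ?thesis using F by simp
  qed
  moreover have "T \<in> \<Phi>"
  proof -
    obtain F where F: "F \<in> \<Phi>" "rank P F = 3"
      using ex[of 3] by auto
    then have "F = T"
      using rank_less[of F T] greatest chain_subset_faces[OF assms(1)] by fastforce
    then show ?thesis using F by simp
  qed
  ultimately have "flag a b c \<subseteq> \<Phi>"
    using abc by (auto simp: flag_def)
  then have "flag a b c = \<Phi>"
    using chain_card(1)[OF assms(1)] card_flag[OF t] assms(2) by (simp add: card_subset_eq)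
  then show thesis
    using that t by blast
qed

text \<open>Since chains have at most five elements, there is a chain of greatest size through
  \<open>F\<close>, and it is maximal.\<close>

lemma face_in_flag:
  assumes "F \<in> faces P"
  shows "\<exists>\<Phi> \<in> flags P. F \<in> \<Phi>"
proof -
  let ?Q = "\<lambda>C. C \<in> Chains (le P) \<and> F \<in> C"
  have "?Q {F}"
    using le_refl[OF assms] by (auto simp: Chains_def)
  moreover have "card C < 6" if "?Q C" for C
    using chain_card(2)[of C] that by simp
  ultimately have "\<exists>C. ?Q C \<and> (\<forall>D. ?Q D \<longrightarrow> card D \<le> card C)"
    by (intro ex_has_greatest_nat[of ?Q "{F}" card 6]) simp_all
  then obtain C where C: "?Q C \<and> (\<forall>D. ?Q D \<longrightarrow> card D \<le> card C)"
    by (rule exE)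
  have "D = C" if "D \<in> Chains (le P)" "C \<subseteq> D" for D
    using C that chain_card(1)[OF that(1)] card_seteq[of D C] by auto
  then show ?thesis
    using C by (auto simp: flags_def)
qed

text \<open>The relation behind the \<open>THE\<close> in \<open>flag_nbr\<close>. It is symmetric
  and can be used before existence and uniqueness of neighbours are known, in particular in a poset
  not yet shown to satisfy the diamond condition.\<close>

definition nbr :: "int \<Rightarrow> 'a set \<Rightarrow> 'a set \<Rightarrow> bool" where
  "nbr j \<Phi> \<Psi> \<longleftrightarrow> \<Phi> \<in> flags P \<and> \<Psi> \<in> flags P \<and> \<Psi> \<noteq> \<Phi> \<and> (\<forall>F. rank P F \<noteq> j \<longrightarrow> (F \<in> \<Psi> \<longleftrightarrow> F \<in> \<Phi>))"

lemma nbr_sym: "nbr j \<Phi> \<Psi> \<Longrightarrow> nbr j \<Psi> \<Phi>"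
  by (auto simp: nbr_def)

lemma nbr_flag_iff:
  assumes "triple a b c" "triple a' b' c'"
  shows "nbr 0 (flag a b c) (flag a' b' c') \<longleftrightarrow> a' \<noteq> a \<and> b' = b \<and> c' = c"
    and "nbr 1 (flag a b c) (flag a' b' c') \<longleftrightarrow> a' = a \<and> b' \<noteq> b \<and> c' = c"
    and "nbr 2 (flag a b c) (flag a' b' c') \<longleftrightarrow> a' = a \<and> b' = b \<and> c' \<noteq> c"
proof -
  note t = assms[unfolded triple_def]
  have mem: "a \<in> flag a' b' c' \<longleftrightarrow> a' = a" "b \<in> flag a' b' c' \<longleftrightarrow> b' = b" "c \<in> flag a' b' c' \<longleftrightarrow> c' = c"
    using t unfolding mem_flag_rank[OF assms(2)] by auto
  have mem': "a \<in> flag a b c" "b \<in> flag a b c" "c \<in> flag a b c"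
    by (auto simp: flag_def)
  have eq: "flag a' b' c' = flag a b c \<longleftrightarrow> a' = a \<and> b' = b \<and> c' = c"
    using flag_eq_iff[OF assms(2,1)] .
  have fl: "flag a b c \<in> flags P" "flag a' b' c' \<in> flags P"
    using assms flag_in_flags by auto
  have r: "(\<forall>F. rank P F \<noteq> j \<longrightarrow> (F \<in> flag a' b' c' \<longleftrightarrow> F \<in> flag a b c)) \<longleftrightarrow>
      (j \<noteq> 0 \<longrightarrow> a' = a) \<and> (j \<noteq> 1 \<longrightarrow> b' = b) \<and> (j \<noteq> 2 \<longrightarrow> c' = c)" for j
  proof
    assume "\<forall>F. rank P F \<noteq> j \<longrightarrow> (F \<in> flag a' b' c' \<longleftrightarrow> F \<in> flag a b c)"
    then show "(j \<noteq> 0 \<longrightarrow> a' = a) \<and> (j \<noteq> 1 \<longrightarrow> b' = b) \<and> (j \<noteq> 2 \<longrightarrow> c' = c)"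
      using mem mem' t by metis
  next
    assume "(j \<noteq> 0 \<longrightarrow> a' = a) \<and> (j \<noteq> 1 \<longrightarrow> b' = b) \<and> (j \<noteq> 2 \<longrightarrow> c' = c)"
    then show "\<forall>F. rank P F \<noteq> j \<longrightarrow> (F \<in> flag a' b' c' \<longleftrightarrow> F \<in> flag a b c)"
      unfolding mem_flag_rank[OF assms(1)] mem_flag_rank[OF assms(2)] using t by auto
  qed
  show "nbr 0 (flag a b c) (flag a' b' c') \<longleftrightarrow> a' \<noteq> a \<and> b' = b \<and> c' = c"
    "nbr 1 (flag a b c) (flag a' b' c') \<longleftrightarrow> a' = a \<and> b' \<noteq> b \<and> c' = c"
    "nbr 2 (flag a b c) (flag a' b' c') \<longleftrightarrow> a' = a \<and> b' = b \<and> c' \<noteq> c"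
    unfolding nbr_def r eq using fl by auto
qed

lemma adjacent_flag_iff:
  assumes "triple a b c" "triple a' b' c'"
  shows "adjacent (flag a b c) (flag a' b' c') \<longleftrightarrow>
    nbr 0 (flag a b c) (flag a' b' c') \<or> nbr 1 (flag a b c) (flag a' b' c') \<or>
    nbr 2 (flag a b c) (flag a' b' c')"
proof -
  \<comment> \<open>Different ranks exclude coincidences across positions, so the difference
    collects exactly the positions at which the triples disagree.\<close>
  have diff: "flag x y z - flag x' y' z' =
      (if x = x' then {} else {x}) \<union> (if y = y' then {} else {y}) \<union> (if z = z' then {} else {z})"
    if "triple x y z" "triple x' y' z'" for x y z x' y' z'
    using that(1)[unfolded triple_def] that(2)[unfolded triple_def] least(2) greatest(2)
    by (auto simp: set_eq_iff mem_flag_rank[OF that(1)] mem_flag_rank[OF that(2)])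
  have "a \<noteq> b" "b \<noteq> c" "a \<noteq> c" "a' \<noteq> b'" "b' \<noteq> c'" "a' \<noteq> c'"
    using assms by (auto simp: triple_def)
  then show ?thesis
    unfolding adjacent_def diff[OF assms] diff[OF assms(2,1)] nbr_flag_iff[OF assms]
    by (auto simp: card_insert_if)
qed

end

section \<open>Diamonds and flag-connectedness in polyhedra\<close>

lemma ex1_other_of_card_2: "card S = 2 \<Longrightarrow> x \<in> S \<Longrightarrow> \<exists>!y. y \<noteq> x \<and> y \<in> S"
  by (auto simp: card_2_iff)

locale polyhedron = ranked_poset3 +
  assumes polytope: "abstract_polytope 3 P"
begin

lemma flag_cases:
  assumes "\<Phi> \<in> flags P"
  obtains a b c where "triple a b c" "\<Phi> = flag a b c"
proof -
  have "card \<Phi> = 5" "\<Phi> \<in> Chains (le P)"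
    using assms polytope by (auto simp: abstract_polytope_def flags_def)
  then show thesis
    using chain_card_5_cases that by blast
qed

lemma flags_subset_faces: "\<Phi> \<in> flags P \<Longrightarrow> \<Phi> \<subseteq> faces P"
  by (auto simp: flags_def dest: chain_subset_faces)

lemma diamond:
  assumes "strictly_below P F G" "rank P F = j - 1" "rank P G = j + 1"
  shows "card {H \<in> faces P. rank P H = j \<and> strictly_below P F H \<and> strictly_below P H G} = 2"
proof -
  have "diamond_condition P"
    using polytope by (simp add: abstract_polytope_def)
  then show ?thesis
    using assms unfolding diamond_condition_def by blast
qed

text \<open>The relevant diamond is the interval from \<open>L\<close> to \<open>b\<close>: a vertex
  below \<open>b\<close> is below \<open>c\<close> by transitivity, so the 2-face does not restrict
  the choice.\<close>

lemma ex1_other_vertex: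
  assumes "triple a b c"
  shows "\<exists>!a'. a' \<noteq> a \<and> triple a' b c"
proof -
  note t = assms[unfolded triple_def] triple_faces[OF assms]
  have "card {H \<in> faces P. rank P H = 0 \<and> strictly_below P L H \<and> strictly_below P H b} = 2"
    using t least by (intro diamond) (auto simp: strictly_below_def)
  moreover have "{H \<in> faces P. rank P H = 0 \<and> strictly_below P L H \<and> strictly_below P H b} =
      {a'. triple a' b c}"
    using t least le_in_faces by (auto simp: strictly_below_def triple_def)
  ultimately show ?thesis
    using ex1_other_of_card_2[of "{a'. triple a' b c}" a] assms by simp
qed

lemma ex1_other_edge:
  assumes "triple a b c"
  shows "\<exists>!b'. b' \<noteq> b \<and> triple a b' c"
proof -
  note t = assms[unfolded triple_def] triple_faces[OF assms]
  have "card {H \<in> faces P. rank P H = 1 \<and> strictly_below P a H \<and> strictly_below P H c} = 2"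
    using t by (intro diamond) (auto simp: strictly_below_def)
  moreover have "{H \<in> faces P. rank P H = 1 \<and> strictly_below P a H \<and> strictly_below P H c} =
      {b'. triple a b' c}"
    using t le_in_faces by (auto simp: strictly_below_def triple_def)
  ultimately show ?thesis
    using ex1_other_of_card_2[of "{b'. triple a b' c}" b] assms by simp
qed

lemma ex1_other_face:
  assumes "triple a b c"
  shows "\<exists>!c'. c' \<noteq> c \<and> triple a b c'"
proof -
  note t = assms[unfolded triple_def] triple_faces[OF assms]
  have "card {H \<in> faces P. rank P H = 2 \<and> strictly_below P b H \<and> strictly_below P H T} = 2"
    using t greatest by (intro diamond) (auto simp: strictly_below_def)
  moreover have "{H \<in> faces P. rank P H = 2 \<and> strictly_below P b H \<and> strictly_below P H T} =
      {c'. triple a b c'}"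
    using t greatest le_in_faces by (auto simp: strictly_below_def triple_def)
  ultimately show ?thesis
    using ex1_other_of_card_2[of "{c'. triple a b c'}" c] assms by simp
qed

lemma ex1_nbr:
  assumes "\<Phi> \<in> flags P" "j \<in> {0, 1, 2}"
  shows "\<exists>!\<Psi>. nbr j \<Phi> \<Psi>"
proof -
  obtain a b c where t: "triple a b c" and \<Phi>: "\<Phi> = flag a b c"
    using flag_cases[OF assms(1)] .
  have cases: "\<exists>a' b' c'. triple a' b' c' \<and> \<Psi> = flag a' b' c'" if "nbr j \<Phi> \<Psi>" for \<Psi>
    using that flag_cases unfolding nbr_def by metis
  consider "j = 0" | "j = 1" | "j = 2"
    using assms(2) by auto
  then show ?thesis
  proof cases
    case 1
    obtain a' where a': "a' \<noteq> a" "triple a' b c" "\<And>x. x \<noteq> a \<Longrightarrow> triple x b c \<Longrightarrow> x = a'"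
      using ex1_other_vertex[OF t] by blast
    show ?thesis
    proof (rule ex1I[of _ "flag a' b c"])
      show "nbr j \<Phi> (flag a' b c)"
        using a'(1,2) t 1 by (simp add: \<Phi> nbr_flag_iff)
      show "\<Psi> = flag a' b c" if n: "nbr j \<Phi> \<Psi>" for \<Psi>
      proof -
        obtain x y z where "triple x y z" "\<Psi> = flag x y z"
          using cases[OF n] by blast
        with n a'(3) t 1 show ?thesis
          unfolding \<Phi> by (metis nbr_flag_iff(1))
      qed
    qed
  next
    case 2
    obtain b' where b': "b' \<noteq> b" "triple a b' c" "\<And>x. x \<noteq> b \<Longrightarrow> triple a x c \<Longrightarrow> x = b'"
      using ex1_other_edge[OF t] by blast
    show ?thesis
    proof (rule ex1I[of _ "flag a b' c"])
      show "nbr j \<Phi> (flag a b' c)"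
        using b'(1,2) t 2 by (simp add: \<Phi> nbr_flag_iff)
      show "\<Psi> = flag a b' c" if n: "nbr j \<Phi> \<Psi>" for \<Psi>
      proof -
        obtain x y z where "triple x y z" "\<Psi> = flag x y z"
          using cases[OF n] by blast
        with n b'(3) t 2 show ?thesis
          unfolding \<Phi> by (metis nbr_flag_iff(2))
      qed
    qed
  next
    case 3
    obtain c' where c': "c' \<noteq> c" "triple a b c'" "\<And>x. x \<noteq> c \<Longrightarrow> triple a b x \<Longrightarrow> x = c'"
      using ex1_other_face[OF t] by blast
    show ?thesis
    proof (rule ex1I[of _ "flag a b c'"])
      show "nbr j \<Phi> (flag a b c')"
        using c'(1,2) t 3 by (simp add: \<Phi> nbr_flag_iff)
      show "\<Psi> = flag a b c'" if n: "nbr j \<Phi> \<Psi>" for \<Psi>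
      proof -
        obtain x y z where "triple x y z" "\<Psi> = flag x y z"
          using cases[OF n] by blast
        with n c'(3) t 3 show ?thesis
          unfolding \<Phi> by (metis nbr_flag_iff(3))
      qed
    qed
  qed
qed

lemma flag_nbr_eq:
  assumes "nbr j \<Phi> \<Psi>" "j \<in> {0, 1, 2}"
  shows "flag_nbr P \<Phi> j = \<Psi>"
proof -
  have \<Phi>: "\<Phi> \<in> flags P"
    using assms by (simp add: nbr_def)
  then have "flag_nbr P \<Phi> j = (THE \<Psi>. nbr j \<Phi> \<Psi>)"
    by (simp add: flag_nbr_def nbr_def)
  then show ?thesis
    using the1_equality[OF ex1_nbr[OF \<Phi> assms(2)] assms(1)] by simp
qed

lemma nbr_flag_nbr: "\<Phi> \<in> flags P \<Longrightarrow> j \<in> {0, 1, 2} \<Longrightarrow> nbr j \<Phi> (flag_nbr P \<Phi> j)"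
  using ex1_nbr flag_nbr_eq by blast

lemma flag_nbr_in_flags: "\<Phi> \<in> flags P \<Longrightarrow> j \<in> {0, 1, 2} \<Longrightarrow> flag_nbr P \<Phi> j \<in> flags P"
  using nbr_flag_nbr by (auto simp: nbr_def)

lemma flag_nbr_invol: "\<Phi> \<in> flags P \<Longrightarrow> j \<in> {0, 1, 2} \<Longrightarrow> flag_nbr P (flag_nbr P \<Phi> j) j = \<Phi>"
  by (rule flag_nbr_eq[OF nbr_sym[OF nbr_flag_nbr]])

lemma adjacent_iff_flag_nbr:
  assumes "\<Phi> \<in> flags P" "\<Psi> \<in> flags P"
  shows "adjacent \<Phi> \<Psi> \<longleftrightarrow> (\<exists>j \<in> {0, 1, 2}. \<Psi> = flag_nbr P \<Phi> j)"
proof -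
  have "adjacent \<Phi> \<Psi> \<longleftrightarrow> nbr 0 \<Phi> \<Psi> \<or> nbr 1 \<Phi> \<Psi> \<or> nbr 2 \<Phi> \<Psi>"
    using flag_cases[OF assms(1)] flag_cases[OF assms(2)] adjacent_flag_iff by metis
  also have "\<dots> \<longleftrightarrow> (\<exists>j \<in> {0, 1, 2}. nbr j \<Phi> \<Psi>)"
    by simp
  also have "\<dots> \<longleftrightarrow> (\<exists>j \<in> {0, 1, 2}. \<Psi> = flag_nbr P \<Phi> j)"
    using flag_nbr_eq nbr_flag_nbr assms by metis
  finally show ?thesis .
qed

lemma adjacent_flag_nbr: "\<Phi> \<in> flags P \<Longrightarrow> j \<in> {0, 1, 2} \<Longrightarrow> adjacent \<Phi> (flag_nbr P \<Phi> j)"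
  using adjacent_iff_flag_nbr[of \<Phi> "flag_nbr P \<Phi> j"] flag_nbr_in_flags[of \<Phi> j] by blast

text \<open>Vertex and 2-face are each tied only to the edge, so changing both gives
  \<open>flag a' b c'\<close> in either order. This is what makes
  \<open>\<sigma>\<^sub>1 \<sigma>\<^sub>2\<close> a half-turn.\<close>

lemma flag_nbr_0_2_commute:
  assumes "\<Phi> \<in> flags P"
  shows "flag_nbr P (flag_nbr P \<Phi> 0) 2 = flag_nbr P (flag_nbr P \<Phi> 2) 0"
proof -
  obtain a b c where t: "triple a b c" and \<Phi>: "\<Phi> = flag a b c"
    using flag_cases[OF assms] .
  obtain a' where a': "a' \<noteq> a" "triple a' b c"
    using ex1_other_vertex[OF t] by blast
  obtain c' where c': "c' \<noteq> c" "triple a b c'"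
    using ex1_other_face[OF t] by blast
  have t': "triple a' b c'"
    using a' c' by (simp add: triple_def)
  have "flag_nbr P \<Phi> 0 = flag a' b c" "flag_nbr P \<Phi> 2 = flag a b c'"
    "flag_nbr P (flag a' b c) 2 = flag a' b c'" "flag_nbr P (flag a b c') 0 = flag a' b c'"
    using a' c' t t' by (auto intro!: flag_nbr_eq simp: \<Phi> nbr_flag_iff)
  then show ?thesis
    by simp
qed

text \<open>Paths of adjacent flags join any two flags, so a property preserved by all neighbour
  maps spreads from one flag to all. Statements about automorphisms thereby reduce to a single
  flag.\<close>

lemma flag_induct [consumes 2, case_names base nbr]:
  assumes "\<Phi> \<in> flags P" "\<Psi> \<in> flags P" "Q \<Phi>"
    and step: "\<And>\<Lambda> j. \<Lambda> \<in> flags P \<Longrightarrow> Q \<Lambda> \<Longrightarrow> j \<in> {0, 1, 2} \<Longrightarrow> Q (flag_nbr P \<Lambda> j)"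
  shows "Q \<Psi>"
proof -
  have "(\<Phi>, \<Psi>) \<in> {(\<Lambda>, \<Lambda>'). \<Lambda> \<in> flags P \<and> \<Lambda>' \<in> flags P \<and> adjacent \<Lambda> \<Lambda>' \<and>
      \<Phi> \<inter> \<Psi> \<subseteq> \<Lambda> \<and> \<Phi> \<inter> \<Psi> \<subseteq> \<Lambda>'}\<^sup>*"
    using polytope assms(1,2) unfolding abstract_polytope_def strongly_flag_connected_def by blast
  then show ?thesis
  proof (induction rule: rtrancl_induct)
    case base
    show ?case by fact
  next
    case (step \<Lambda> \<Lambda>')
    then show ?case
      using adjacent_iff_flag_nbr assms(4) by auto
  qed
qed

end

section \<open>Automorphisms of polyhedra\<close>

lemma aut_group_carrierD:
  assumes "\<gamma> \<in> carrier (aut_group P)"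
  shows "F \<in> faces P \<Longrightarrow> \<gamma> F \<in> faces P"
    and "F \<in> faces P \<Longrightarrow> G \<in> faces P \<Longrightarrow> (\<gamma> F, \<gamma> G) \<in> le P \<longleftrightarrow> (F, G) \<in> le P"
    and "F \<in> faces P \<Longrightarrow> G \<in> faces P \<Longrightarrow> \<gamma> F = \<gamma> G \<longleftrightarrow> F = G"
    and "G \<in> faces P \<Longrightarrow> \<exists>F \<in> faces P. \<gamma> F = G"
    and "\<gamma> \<in> extensional (faces P)"
proof -
  have bij: "bij_betw \<gamma> (faces P) (faces P)" and ext: "\<gamma> \<in> extensional (faces P)"
    using assms by (auto simp: aut_group_def Bij_def)
  show "F \<in> faces P \<Longrightarrow> \<gamma> F \<in> faces P"
    using bij by (auto simp: bij_betw_def)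
  show "F \<in> faces P \<Longrightarrow> G \<in> faces P \<Longrightarrow> (\<gamma> F, \<gamma> G) \<in> le P \<longleftrightarrow> (F, G) \<in> le P"
    using assms by (auto simp: aut_group_def)
  show "F \<in> faces P \<Longrightarrow> G \<in> faces P \<Longrightarrow> \<gamma> F = \<gamma> G \<longleftrightarrow> F = G"
    using bij by (auto simp: bij_betw_def inj_on_def)
  show "G \<in> faces P \<Longrightarrow> \<exists>F \<in> faces P. \<gamma> F = G"
    using bij by (metis bij_betw_def imageE)
  show "\<gamma> \<in> extensional (faces P)" by fact
qed

lemma aut_mult_apply: "F \<in> faces P \<Longrightarrow> (\<gamma> \<otimes>\<^bsub>aut_group P\<^esub> \<delta>) F = \<delta> (\<gamma> F)"
  by (simp add: aut_group_def compose_def)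

lemma aut_one_apply: "F \<in> faces P \<Longrightarrow> \<one>\<^bsub>aut_group P\<^esub> F = F"
  by (simp add: aut_group_def)

lemma aut_mult_image: "\<Phi> \<subseteq> faces P \<Longrightarrow> (\<gamma> \<otimes>\<^bsub>aut_group P\<^esub> \<delta>) ` \<Phi> = \<delta> ` \<gamma> ` \<Phi>"
  by (auto simp: aut_mult_apply subset_iff image_iff)

lemma aut_one_image: "\<Phi> \<subseteq> faces P \<Longrightarrow> \<one>\<^bsub>aut_group P\<^esub> ` \<Phi> = \<Phi>"
  by (auto simp: aut_one_apply subset_iff image_iff)

lemma group_aut_group: "group (aut_group P)"
proof (rule groupI)
  fix \<gamma> \<delta> assume \<gamma>\<delta>: "\<gamma> \<in> carrier (aut_group P)" "\<delta> \<in> carrier (aut_group P)"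
  then have "compose (faces P) \<delta> \<gamma> \<in> Bij (faces P)"
    by (intro compose_Bij) (auto simp: aut_group_def)
  then show "\<gamma> \<otimes>\<^bsub>aut_group P\<^esub> \<delta> \<in> carrier (aut_group P)"
    using aut_group_carrierD(1,2)[OF \<gamma>\<delta>(1)] aut_group_carrierD(2)[OF \<gamma>\<delta>(2)]
    by (auto simp: aut_group_def compose_def)
next
  show "\<one>\<^bsub>aut_group P\<^esub> \<in> carrier (aut_group P)"
    by (auto simp: aut_group_def id_Bij)
next
  fix \<alpha> \<beta> \<gamma>
  assume \<alpha>: "\<alpha> \<in> carrier (aut_group P)"
  have "\<alpha> \<in> faces P \<rightarrow> faces P"
    using aut_group_carrierD(1)[OF \<alpha>] by (rule Pi_I)
  then show "\<alpha> \<otimes>\<^bsub>aut_group P\<^esub> \<beta> \<otimes>\<^bsub>aut_group P\<^esub> \<gamma> = \<alpha> \<otimes>\<^bsub>aut_group P\<^esub> (\<beta> \<otimes>\<^bsub>aut_group P\<^esub> \<gamma>)"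
    by (simp add: aut_group_def compose_assoc)
next
  fix \<gamma> assume \<gamma>: "\<gamma> \<in> carrier (aut_group P)"
  show "\<one>\<^bsub>aut_group P\<^esub> \<otimes>\<^bsub>aut_group P\<^esub> \<gamma> = \<gamma>"
    using aut_group_carrierD(5)[OF \<gamma>] by (auto simp: aut_group_def compose_def extensional_def)
next
  fix \<gamma> assume \<gamma>: "\<gamma> \<in> carrier (aut_group P)"
  let ?\<delta> = "\<lambda>F \<in> faces P. inv_into (faces P) \<gamma> F"
  have B: "\<gamma> \<in> Bij (faces P)"
    using \<gamma> by (auto simp: aut_group_def)
  then have im: "\<gamma> ` faces P = faces P"
    by (auto simp: Bij_def bij_betw_def)
  have inv: "\<gamma> (inv_into (faces P) \<gamma> F) = F" "inv_into (faces P) \<gamma> F \<in> faces P" if "F \<in> faces P" for F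
    using that im by (auto simp: f_inv_into_f inv_into_into)
  have "?\<delta> \<in> carrier (aut_group P)"
    using restrict_inv_into_Bij[OF B] inv aut_group_carrierD(2)[OF \<gamma>] by (auto simp: aut_group_def) metis+
  moreover have "?\<delta> \<otimes>\<^bsub>aut_group P\<^esub> \<gamma> = \<one>\<^bsub>aut_group P\<^esub>"
    using inv by (auto simp: aut_group_def compose_def)
  ultimately show "\<exists>\<delta> \<in> carrier (aut_group P). \<delta> \<otimes>\<^bsub>aut_group P\<^esub> \<gamma> = \<one>\<^bsub>aut_group P\<^esub>"
    by blast
qed

context polyhedron
begin

abbreviation \<Gamma> where "\<Gamma> \<equiv> aut_group P"

sublocale A: group \<Gamma>
  by (rule group_aut_group)

text \<open>Automorphisms are defined through the order, with no mention of rank, so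
  \<open>L\<close> is recognised in its image as the least element.\<close>

lemma aut_least:
  assumes \<gamma>: "\<gamma> \<in> carrier \<Gamma>"
  shows "\<gamma> L = L"
proof -
  note \<gamma>D = aut_group_carrierD[OF \<gamma>]
  obtain F where F: "F \<in> faces P" "\<gamma> F = L"
    using \<gamma>D(4) least(1) by blast
  have "(\<gamma> L, L) \<in> le P"
    using \<gamma>D(2)[OF least(1) F(1)] least(3)[OF F(1)] F(2) by simp
  moreover have "(L, \<gamma> L) \<in> le P"
    using least \<gamma>D(1) by blast
  ultimately show ?thesis
    using le_antisym by simp
qed

lemma aut_greatest:
  assumes \<gamma>: "\<gamma> \<in> carrier \<Gamma>"
  shows "\<gamma> T = T"
proof -
  note \<gamma>D = aut_group_carrierD[OF \<gamma>]
  obtain F where F: "F \<in> faces P" "\<gamma> F = T"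
    using \<gamma>D(4) greatest(1) by blast
  have "(T, \<gamma> T) \<in> le P"
    using \<gamma>D(2)[OF F(1) greatest(1)] greatest(3)[OF F(1)] F(2) by simp
  moreover have "(\<gamma> T, T) \<in> le P"
    using greatest \<gamma>D(1) by blast
  ultimately show ?thesis
    using le_antisym by simp
qed

text \<open>Preservation of rank is derived: with \<open>L\<close> and \<open>T\<close> fixed, the
  images have strictly increasing integer ranks strictly between -1 and 3, which leaves only 0, 1,
  2.\<close>

lemma aut_triple:
  assumes \<gamma>: "\<gamma> \<in> carrier \<Gamma>" and t: "triple a b c"
  shows "triple (\<gamma> a) (\<gamma> b) (\<gamma> c)"
proof -
  note \<gamma>D = aut_group_carrierD[OF \<gamma>]
  note f = t[unfolded triple_def] triple_faces[OF t]
  have ab: "(\<gamma> a, \<gamma> b) \<in> le P" and bc: "(\<gamma> b, \<gamma> c) \<in> le P"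
    using f \<gamma>D(2) by auto
  have lt: "rank P (\<gamma> F) < rank P (\<gamma> G)"
    if "(F, G) \<in> le P" "rank P F < rank P G" "F \<in> faces P" "G \<in> faces P" for F G
    using that \<gamma>D(2,3) by (intro rank_less) auto
  have "-1 < rank P (\<gamma> a)"
    using lt[OF least(3)[OF f(2)] _ least(1) f(2)] f(1) least(2) aut_least[OF \<gamma>] by simp
  moreover have "rank P (\<gamma> c) < 3"
    using lt[OF greatest(3)[OF f(4)] _ f(4) greatest(1)] f(1) greatest(2) aut_greatest[OF \<gamma>] by simp
  moreover have "rank P (\<gamma> a) < rank P (\<gamma> b)" "rank P (\<gamma> b) < rank P (\<gamma> c)"
    using lt f by auto
  ultimately show ?thesis
    using ab bc by (auto simp: triple_def)
qed

lemma aut_image_flag: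
  assumes "\<gamma> \<in> carrier \<Gamma>"
  shows "\<gamma> ` flag a b c = flag (\<gamma> a) (\<gamma> b) (\<gamma> c)"
  by (simp add: flag_def aut_least[OF assms] aut_greatest[OF assms])

lemma aut_image_in_flags:
  assumes "\<gamma> \<in> carrier \<Gamma>" "\<Phi> \<in> flags P"
  shows "\<gamma> ` \<Phi> \<in> flags P"
proof -
  obtain a b c where "triple a b c" "\<Phi> = flag a b c"
    using flag_cases[OF assms(2)] .
  then show ?thesis
    using aut_image_flag[OF assms(1)] aut_triple[OF assms(1)] flag_in_flags by simp
qed

lemma aut_flag_nbr:
  assumes \<gamma>: "\<gamma> \<in> carrier \<Gamma>" and \<Phi>: "\<Phi> \<in> flags P" and j: "j \<in> {0, 1, 2}"
  shows "\<gamma> ` flag_nbr P \<Phi> j = flag_nbr P (\<gamma> ` \<Phi>) j"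
proof -
  obtain a b c where t: "triple a b c" "\<Phi> = flag a b c"
    using flag_cases[OF \<Phi>] .
  obtain a' b' c' where t': "triple a' b' c'" "flag_nbr P \<Phi> j = flag a' b' c'"
    using flag_cases[OF flag_nbr_in_flags[OF \<Phi> j]] .
  have n: "nbr j (flag a b c) (flag a' b' c')"
    using nbr_flag_nbr[OF \<Phi> j] t t' by simp
  note inj = aut_group_carrierD(3)[OF \<gamma>] and f = triple_faces[OF t(1)] triple_faces[OF t'(1)]
  have "nbr j (flag (\<gamma> a) (\<gamma> b) (\<gamma> c)) (flag (\<gamma> a') (\<gamma> b') (\<gamma> c'))"
    using j n nbr_flag_iff[OF t(1) t'(1)]
      nbr_flag_iff[OF aut_triple[OF \<gamma> t(1)] aut_triple[OF \<gamma> t'(1)]]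
    by (auto simp: inj f)
  then show ?thesis
    unfolding t'(2) unfolding t(2) aut_image_flag[OF \<gamma>] by (rule flag_nbr_eq[OF _ j, symmetric])
qed

text \<open>Automorphisms commute with neighbour maps, so stability of one flag spreads to all
  flags. A flag stable as a set is fixed pointwise, its proper members being told apart by rank, and
  every face lies in a flag.\<close>

lemma aut_fix_flag_imp_one:
  assumes \<gamma>: "\<gamma> \<in> carrier \<Gamma>" and \<Phi>: "\<Phi> \<in> flags P" and stable: "\<gamma> ` \<Phi> = \<Phi>"
  shows "\<gamma> = \<one>\<^bsub>\<Gamma>\<^esub>"
proof
  fix F
  have all: "\<gamma> ` \<Psi> = \<Psi>" if "\<Psi> \<in> flags P" for \<Psi>
    using \<Phi> that
  proof (induction rule: flag_induct)
    case base
    show ?case by (rule stable)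
  next
    case (nbr \<Lambda> j)
    then show ?case
      by (simp only: aut_flag_nbr[OF \<gamma>])
  qed
  show "\<gamma> F = \<one>\<^bsub>\<Gamma>\<^esub> F"
  proof (cases "F \<in> faces P")
    case True
    obtain \<Psi> where \<Psi>: "\<Psi> \<in> flags P" "F \<in> \<Psi>"
      using face_in_flag[OF True] by blast
    obtain a b c where t: "triple a b c" "\<Psi> = flag a b c"
      using flag_cases[OF \<Psi>(1)] .
    have "flag (\<gamma> a) (\<gamma> b) (\<gamma> c) = flag a b c"
      using all[OF \<Psi>(1)] t aut_image_flag[OF \<gamma>] by simp
    then have "\<gamma> a = a" "\<gamma> b = b" "\<gamma> c = c"
      using flag_eq_iff[OF aut_triple[OF \<gamma> t(1)] t(1)] by auto
    then show ?thesis
      using \<Psi>(2) t(2) aut_least[OF \<gamma>] aut_greatest[OF \<gamma>] True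
      by (auto simp: flag_def aut_one_apply)
  next
    case False
    \<comment> \<open>Both maps are extensional and take the same default value here.\<close>
    then show ?thesis
      using aut_group_carrierD(5)[OF \<gamma>] by (simp add: aut_group_def extensional_def)
  qed
qed

text \<open>The action on flags is free. The left factor acts first, so \<open>\<gamma>\<close>
  followed by the inverse of \<open>\<delta>\<close> stabilises \<open>\<Phi>\<close>.\<close>

lemma aut_eqI:
  assumes \<gamma>: "\<gamma> \<in> carrier \<Gamma>" and \<delta>: "\<delta> \<in> carrier \<Gamma>" and \<Phi>: "\<Phi> \<in> flags P" and eq: "\<gamma> ` \<Phi> = \<delta> ` \<Phi>"
  shows "\<gamma> = \<delta>"
proof -
  note sub = flags_subset_faces[OF \<Phi>]
  have "(\<gamma> \<otimes>\<^bsub>\<Gamma>\<^esub> inv\<^bsub>\<Gamma>\<^esub> \<delta>) ` \<Phi> = (\<delta> \<otimes>\<^bsub>\<Gamma>\<^esub> inv\<^bsub>\<Gamma>\<^esub> \<delta>) ` \<Phi>"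
    by (simp only: aut_mult_image[OF sub] eq)
  also have "\<dots> = \<Phi>"
    using \<delta> aut_one_image[OF sub] by simp
  finally have "\<gamma> \<otimes>\<^bsub>\<Gamma>\<^esub> inv\<^bsub>\<Gamma>\<^esub> \<delta> = \<one>\<^bsub>\<Gamma>\<^esub>"
    using \<gamma> \<delta> \<Phi> by (intro aut_fix_flag_imp_one) auto
  then show ?thesis
    using \<gamma> \<delta> by (metis A.inv_closed A.inv_equality A.inv_inv)
qed

lemma base_in_flags: "base P \<in> flags P"
  using polytope by (simp add: abstract_polytope_def)

section \<open>Base reflections and rotations\<close>

lemma the_aut:
  assumes "\<gamma> \<in> carrier \<Gamma>" "\<gamma> ` base P = \<Phi>"
  shows "(THE \<gamma>. \<gamma> \<in> carrier \<Gamma> \<and> \<gamma> ` base P = \<Phi>) = \<gamma>"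
proof (rule the_equality)
  show "\<gamma> \<in> carrier \<Gamma> \<and> \<gamma> ` base P = \<Phi>"
    using assms by simp
  show "\<delta> = \<gamma>" if "\<delta> \<in> carrier \<Gamma> \<and> \<delta> ` base P = \<Phi>" for \<delta>
    using that assms by (intro aut_eqI[OF _ _ base_in_flags]) simp_all
qed

lemma refl_gen:
  assumes "flag_transitive P" "j \<in> {0, 1, 2}"
  shows "refl_gen P j \<in> carrier \<Gamma>" "refl_gen P j ` base P = flag_nbr P (base P) j"
proof -
  obtain \<gamma> where \<gamma>: "\<gamma> \<in> carrier \<Gamma>" "\<gamma> ` base P = flag_nbr P (base P) j"
    using assms base_in_flags flag_nbr_in_flags[OF base_in_flags assms(2)]
    unfolding flag_transitive_def by blast
  then have "refl_gen P j = \<gamma>"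
    unfolding refl_gen_def by (rule the_aut)
  then show "refl_gen P j \<in> carrier \<Gamma>" "refl_gen P j ` base P = flag_nbr P (base P) j"
    using \<gamma> by auto
qed

lemma rot_gen_flag_transitive:
  assumes "flag_transitive P" "i \<in> {1, 2}"
  shows "rot_gen P i \<in> carrier \<Gamma>"
    and "rot_gen P i ` base P = flag_nbr P (flag_nbr P (base P) i) (i - 1)"
proof -
  have i: "i - 1 \<in> {0, 1, 2}" "i \<in> {0, 1, 2}"
    using assms(2) by auto
  note r = refl_gen[OF assms(1) i(1)] refl_gen[OF assms(1) i(2)]
  have eq: "rot_gen P i = refl_gen P (i - 1) \<otimes>\<^bsub>\<Gamma>\<^esub> refl_gen P i"
    using assms(1) by (simp add: rot_gen_def)
  show "rot_gen P i \<in> carrier \<Gamma>"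
    using r unfolding eq by simp
  \<comment> \<open>The reflection of index i is applied to the (i-1)-neighbour of the base flag.
    Commuting it past the neighbour map gives the (i-1)-neighbour of the i-neighbour, which explains
    the reversed order of the indices.\<close>
  show "rot_gen P i ` base P = flag_nbr P (flag_nbr P (base P) i) (i - 1)"
    unfolding eq aut_mult_image[OF flags_subset_faces[OF base_in_flags]] r(2)
    using aut_flag_nbr[OF r(3) base_in_flags i(1)] r(4) by simp
qed

lemma orbit_refl: "\<Phi> \<in> flags P \<Longrightarrow> \<Phi> \<in> orbit \<Gamma> (`) \<Phi>"
  unfolding orbit_def using aut_one_image[OF flags_subset_faces] by fastforce

text \<open>Transitivity would leave a single orbit, while the base flag and its neighbours lie in
  different ones. The lemma selects the second branch of \<open>rot_gen\<close> and of
  \<open>rotation_group\<close>.\<close>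

lemma chiral_not_flag_transitive:
  assumes "chiral 3 P"
  shows "\<not> flag_transitive P"
proof
  assume ft: "flag_transitive P"
  have all: "orbit \<Gamma> (`) \<Phi> = flags P" if \<Phi>: "\<Phi> \<in> flags P" for \<Phi>
  proof
    show "orbit \<Gamma> (`) \<Phi> \<subseteq> flags P"
      using aut_image_in_flags[OF _ \<Phi>] by (auto simp: orbit_def)
    show "flags P \<subseteq> orbit \<Gamma> (`) \<Phi>"
    proof
      fix \<Psi> assume "\<Psi> \<in> flags P"
      then obtain \<gamma> where "\<gamma> \<in> carrier \<Gamma>" "\<gamma> ` \<Phi> = \<Psi>"
        using ft \<Phi> unfolding flag_transitive_def by blast
      then show "\<Psi> \<in> orbit \<Gamma> (`) \<Phi>"
        by (auto simp: orbit_def)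
    qed
  qed
  let ?\<Psi> = "flag_nbr P (base P) 0"
  have "?\<Psi> \<in> flags P" "adjacent (base P) ?\<Psi>"
    using base_in_flags flag_nbr_in_flags adjacent_flag_nbr by simp_all
  then have "orbit \<Gamma> (`) (base P) \<noteq> orbit \<Gamma> (`) ?\<Psi>"
    using assms base_in_flags unfolding chiral_def by blast
  then show False
    using all base_in_flags \<open>?\<Psi> \<in> flags P\<close> by simp
qed

text \<open>Each neighbour step changes the orbit, and there are only two orbits, so two steps lead
  back to the orbit of the base flag. This supplies the automorphism to which the \<open>THE\<close>
  in \<open>rot_gen\<close> refers.\<close>

lemma rot_gen_chiral:
  assumes ch: "chiral 3 P" and i: "i \<in> {1, 2}"
  shows "rot_gen P i \<in> carrier \<Gamma>"
    and "rot_gen P i ` base P = flag_nbr P (flag_nbr P (base P) i) (i - 1)"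
proof -
  let ?B = "base P" and ?O = "orbit \<Gamma> (`)"
  let ?B1 = "flag_nbr P ?B i"
  let ?B2 = "flag_nbr P ?B1 (i - 1)"
  have j: "i - 1 \<in> {0, 1, 2}" "i \<in> {0, 1, 2}"
    using i by auto
  have fl: "?B \<in> flags P" "?B1 \<in> flags P" "?B2 \<in> flags P"
    using base_in_flags flag_nbr_in_flags j by auto
  have "adjacent ?B ?B1" "adjacent ?B1 ?B2"
    using adjacent_flag_nbr fl j by simp_all
  then have ne: "?O ?B \<noteq> ?O ?B1" "?O ?B1 \<noteq> ?O ?B2"
    using ch fl unfolding chiral_def by blast+
  have card: "card (orbits \<Gamma> (flags P) (`)) = 2"
    using ch by (simp add: chiral_def)
  have mem: "?O ?B \<in> orbits \<Gamma> (flags P) (`)" "?O ?B1 \<in> orbits \<Gamma> (flags P) (`)"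
    "?O ?B2 \<in> orbits \<Gamma> (flags P) (`)"
    using fl by (auto simp: orbits_def)
  have "?O ?B = ?O ?B2"
    using card mem ne by (auto simp: card_2_iff)
  then have "?B2 \<in> ?O ?B"
    using orbit_refl[OF fl(3)] by simp
  then obtain \<gamma> where \<gamma>: "\<gamma> \<in> carrier \<Gamma>" "\<gamma> ` ?B = ?B2"
    by (auto simp: orbit_def)
  have "rot_gen P i = (THE \<gamma>. \<gamma> \<in> carrier \<Gamma> \<and> \<gamma> ` ?B = ?B2)"
    using chiral_not_flag_transitive[OF ch] by (simp add: rot_gen_def)
  then have "rot_gen P i = \<gamma>"
    using the_aut[OF \<gamma>] by simp
  then show "rot_gen P i \<in> carrier \<Gamma>" "rot_gen P i ` ?B = ?B2"
    using \<gamma> by auto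
qed

section \<open>Stabilisers and the absence of reflections among rotations\<close>

lemma fixing_subgroup:
  assumes F: "F \<in> faces P"
  shows "subgroup {\<gamma> \<in> carrier \<Gamma>. \<gamma> F = F} \<Gamma>"
proof (rule A.subgroupI)
  show "{\<gamma> \<in> carrier \<Gamma>. \<gamma> F = F} \<noteq> {}"
    using aut_one_apply[OF F] by blast
next
  fix \<gamma> assume \<gamma>: "\<gamma> \<in> {\<gamma> \<in> carrier \<Gamma>. \<gamma> F = F}"
  have "(\<gamma> \<otimes>\<^bsub>\<Gamma>\<^esub> inv\<^bsub>\<Gamma>\<^esub> \<gamma>) F = (inv\<^bsub>\<Gamma>\<^esub> \<gamma>) (\<gamma> F)"
    by (rule aut_mult_apply[OF F])
  then show "inv\<^bsub>\<Gamma>\<^esub> \<gamma> \<in> {\<gamma> \<in> carrier \<Gamma>. \<gamma> F = F}"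
    using \<gamma> aut_one_apply[OF F] by simp
qed (auto simp: aut_mult_apply[OF F])

text \<open>By freeness such a rotation would be \<open>\<rho>\<^sub>1\<close>. Solving
  \<open>\<sigma>\<^sub>1 = \<rho>\<^sub>0 \<rho>\<^sub>1\<close> and
  \<open>\<sigma>\<^sub>2 = \<rho>\<^sub>1 \<rho>\<^sub>2\<close> would put all three reflections
  into the rotation group, which would then reach every flag and be the whole automorphism group, of
  index 1 instead of 2.\<close>

lemma directly_regular_no_reflection:
  assumes dr: "directly_regular 3 P" and \<gamma>: "\<gamma> \<in> carrier (rotation_group 3 P)"
  shows "\<gamma> ` base P \<noteq> flag_nbr P (base P) 1"
proof
  assume \<gamma>1: "\<gamma> ` base P = flag_nbr P (base P) 1"
  have ft: "flag_transitive P" and card: "card (rcosets\<^bsub>\<Gamma>\<^esub> carrier (rotation_group 3 P)) = 2"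
    using dr by (auto simp: directly_regular_def regular_def)
  let ?R = "carrier (rotation_group 3 P)"
  have R: "rotation_group 3 P = subgroup_generated \<Gamma> {rot_gen P 1, rot_gen P 2}"
  proof -
    have "{1..int 3 - 1} = {1, 2}" by auto
    then show ?thesis
      using ft by (simp add: rotation_group_def)
  qed
  have sub: "subgroup ?R \<Gamma>"
    unfolding R by (rule A.subgroup_subgroup_generated)
  note rg = refl_gen[OF ft] and sg = rot_gen_flag_transitive(1)[OF ft]
  have s: "rot_gen P 1 \<in> ?R" "rot_gen P 2 \<in> ?R"
    using sg[of 1] sg[of 2] unfolding R by (auto simp: carrier_subgroup_generated intro: generate.incl)
  have "\<gamma> = refl_gen P 1"
    using rg[of 1] \<gamma>1 \<gamma> subgroup.subset[OF sub] base_in_flags by (intro aut_eqI) auto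
  then have r1: "refl_gen P 1 \<in> ?R"
    using \<gamma> by simp
  have "rot_gen P 1 = refl_gen P 0 \<otimes>\<^bsub>\<Gamma>\<^esub> refl_gen P 1" "rot_gen P 2 = refl_gen P 1 \<otimes>\<^bsub>\<Gamma>\<^esub> refl_gen P 2"
    using ft by (auto simp: rot_gen_def)
  then have "refl_gen P 0 = rot_gen P 1 \<otimes>\<^bsub>\<Gamma>\<^esub> inv\<^bsub>\<Gamma>\<^esub> refl_gen P 1"
    "refl_gen P 2 = inv\<^bsub>\<Gamma>\<^esub> refl_gen P 1 \<otimes>\<^bsub>\<Gamma>\<^esub> rot_gen P 2"
    using rg(1)[of 0] rg(1)[of 1] rg(1)[of 2] by (auto simp: A.m_assoc A.inv_solve_left A.inv_solve_right)
  then have r: "refl_gen P j \<in> ?R" if "j \<in> {0, 1, 2}" for j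
    using that r1 s subgroup.m_closed[OF sub] subgroup.m_inv_closed[OF sub] by auto
  have reach: "\<exists>\<delta> \<in> ?R. \<delta> ` base P = \<Psi>" if "\<Psi> \<in> flags P" for \<Psi>
    using base_in_flags that
  proof (induction rule: flag_induct)
    case base
    then show ?case
      using subgroup.one_closed[OF sub] aut_one_image[OF flags_subset_faces[OF base_in_flags]] by blast
  next
    case (nbr \<Lambda> j)
    then obtain \<delta> where \<delta>: "\<delta> \<in> ?R" "\<delta> ` base P = \<Lambda>"
      by blast
    \<comment> \<open>The new reflection goes on the left: it acts first and turns the base flag
      into its neighbour, which \<open>\<delta>\<close> carries to the neighbour of
      \<open>\<Lambda>\<close>.\<close>
    have "(refl_gen P j \<otimes>\<^bsub>\<Gamma>\<^esub> \<delta>) ` base P = flag_nbr P \<Lambda> j"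
      using aut_flag_nbr[OF _ base_in_flags nbr(2), of \<delta>] \<delta> subgroup.subset[OF sub] rg(2)[OF nbr(2)]
      by (auto simp: aut_mult_image[OF flags_subset_faces[OF base_in_flags]])
    then show ?case
      using subgroup.m_closed[OF sub r[OF nbr(2)] \<delta>(1)] by blast
  qed
  have "\<delta> \<in> ?R" if "\<delta> \<in> carrier \<Gamma>" for \<delta>
    using reach[OF aut_image_in_flags[OF that base_in_flags]] aut_eqI[OF _ that base_in_flags]
      subgroup.subset[OF sub] by blast
  then have "?R = carrier \<Gamma>"
    using subgroup.subset[OF sub] by blast
  then have "rcosets\<^bsub>\<Gamma>\<^esub> ?R = {carrier \<Gamma>}"
    using A.coset_join2[OF _ A.subgroup_self] by (auto simp: RCOSETS_def)
  then show False
    using card by simp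
qed

lemma orbit_image:
  assumes \<gamma>: "\<gamma> \<in> carrier \<Gamma>" and \<Phi>: "\<Phi> \<in> flags P"
  shows "orbit \<Gamma> (`) (\<gamma> ` \<Phi>) = orbit \<Gamma> (`) \<Phi>"
proof
  note sub = flags_subset_faces[OF \<Phi>]
  show "orbit \<Gamma> (`) (\<gamma> ` \<Phi>) \<subseteq> orbit \<Gamma> (`) \<Phi>"
    unfolding orbit_def using aut_mult_image[OF sub, symmetric] \<gamma> by blast
  show "orbit \<Gamma> (`) \<Phi> \<subseteq> orbit \<Gamma> (`) (\<gamma> ` \<Phi>)"
  proof
    fix \<Psi> assume "\<Psi> \<in> orbit \<Gamma> (`) \<Phi>"
    then obtain \<delta> where \<delta>: "\<delta> \<in> carrier \<Gamma>" "\<Psi> = \<delta> ` \<Phi>"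
      by (auto simp: orbit_def)
    have "(\<gamma> \<otimes>\<^bsub>\<Gamma>\<^esub> (inv\<^bsub>\<Gamma>\<^esub> \<gamma> \<otimes>\<^bsub>\<Gamma>\<^esub> \<delta>)) ` \<Phi> = \<delta> ` \<Phi>"
      using \<gamma> \<delta> by (simp flip: A.m_assoc)
    then have "(inv\<^bsub>\<Gamma>\<^esub> \<gamma> \<otimes>\<^bsub>\<Gamma>\<^esub> \<delta>) ` \<gamma> ` \<Phi> = \<Psi>"
      unfolding aut_mult_image[OF sub] \<delta>(2) .
    then show "\<Psi> \<in> orbit \<Gamma> (`) (\<gamma> ` \<Phi>)"
      using \<gamma> \<delta> unfolding orbit_def by blast
  qed
qed

lemma chiral_no_reflection:
  assumes ch: "chiral 3 P" and \<gamma>: "\<gamma> \<in> carrier \<Gamma>"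
  shows "\<gamma> ` base P \<noteq> flag_nbr P (base P) 1"
proof
  assume \<gamma>1: "\<gamma> ` base P = flag_nbr P (base P) 1"
  have "adjacent (base P) (\<gamma> ` base P)" "\<gamma> ` base P \<in> flags P"
    using adjacent_flag_nbr base_in_flags flag_nbr_in_flags unfolding \<gamma>1 by simp_all
  then have "orbit \<Gamma> (`) (base P) \<noteq> orbit \<Gamma> (`) (\<gamma> ` base P)"
    using ch base_in_flags unfolding chiral_def by blast
  then show False
    using orbit_image[OF \<gamma> base_in_flags] by simp
qed

end

text \<open>The algebra extracted from a chiral or directly regular polyhedron. The trivial
  intersection, together with nontriviality of both generators, keeps the two middle faces of each
  diamond of the coset poset distinct.\<close>

locale rotation_pair = group G for G (structure) +
  fixes s1 s2
  assumes s1_closed [simp, intro]: "s1 \<in> carrier G"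
    and s2_closed [simp, intro]: "s2 \<in> carrier G"
    and s1_s2_invol: "s1 \<otimes> s2 \<otimes> (s1 \<otimes> s2) = \<one>"
    and s1_ne_one: "s1 \<noteq> \<one>"
    and s2_ne_one: "s2 \<noteq> \<one>"
    and generate_inter: "generate G {s1} \<inter> generate G {s2} \<subseteq> {\<one>}"

section \<open>Rotation groups of polyhedra as rotation pairs\<close>

context polyhedron
begin

lemma rotation_pair_rotation_group:
  assumes rotary: "chiral 3 P \<or> directly_regular 3 P"
  shows "rotation_pair (rotation_group 3 P) (rot_gen P 1) (rot_gen P 2)"
proof -
  let ?R = "rotation_group 3 P" and ?s1 = "rot_gen P 1" and ?s2 = "rot_gen P 2" and ?B = "base P"
  let ?n = "flag_nbr P"
  note sub = flags_subset_faces[OF base_in_flags]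
  have s: "?s1 \<in> carrier \<Gamma>" "?s2 \<in> carrier \<Gamma>" "?s1 ` ?B = ?n (?n ?B 1) 0" "?s2 ` ?B = ?n (?n ?B 2) 1"
    using rotary rot_gen_chiral[of 1] rot_gen_chiral[of 2]
      rot_gen_flag_transitive[of 1] rot_gen_flag_transitive[of 2]
    by (auto simp: directly_regular_def regular_def)
  \<comment> \<open>Both branches of \<open>rotation_group\<close> are brought to one form, a
    subgroup of \<open>\<Gamma>\<close> with the operations of \<open>\<Gamma>\<close>, so that the
    rest is uniform.\<close>
  have R: "subgroup (carrier ?R) \<Gamma> \<and> ?R = \<Gamma>\<lparr>carrier := carrier ?R\<rparr> \<and> ?s1 \<in> carrier ?R \<and> ?s2 \<in> carrier ?R"
  proof (cases "flag_transitive P")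
    case True
    have "{1..int 3 - 1} = {1, 2}" by auto
    then have "?R = subgroup_generated \<Gamma> {?s1, ?s2}"
      using True by (simp add: rotation_group_def)
    then show ?thesis
      using A.subgroup_subgroup_generated[of "{?s1, ?s2}"] s(1,2)
      by (simp add: subgroup_generated_def generate.incl)
  next
    case False
    then show ?thesis
      using s A.subgroup_self by (simp add: rotation_group_def)
  qed
  then have Rsub: "subgroup (carrier ?R) \<Gamma>" and Req: "?R = \<Gamma>\<lparr>carrier := carrier ?R\<rparr>"
    and sR: "?s1 \<in> carrier ?R" "?s2 \<in> carrier ?R"
    by auto
  have ops: "mult ?R = mult \<Gamma>" "\<one>\<^bsub>?R\<^esub> = \<one>\<^bsub>\<Gamma>\<^esub>"
    by (subst Req, simp)+
  have gen: "generate ?R {x} = generate \<Gamma> {x}" if "x \<in> carrier ?R" for x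
    by (subst Req) (rule A.generate_consistent[OF _ Rsub], use that in simp)
  have no_refl: "\<gamma> ` ?B \<noteq> ?n ?B 1" if "\<gamma> \<in> carrier ?R" for \<gamma>
    using rotary chiral_no_reflection directly_regular_no_reflection that subgroup.subset[OF Rsub]
    by blast
  obtain a b c where t: "triple a b c" and B: "?B = flag a b c"
    using flag_cases[OF base_in_flags] .
  have fl: "?n ?B 1 \<in> flags P" "?n ?B 2 \<in> flags P"
    using flag_nbr_in_flags[OF base_in_flags] by auto
  have "nbr 1 ?B (?n ?B 1)" "nbr 0 (?n ?B 1) (?n (?n ?B 1) 0)"
    "nbr 2 ?B (?n ?B 2)" "nbr 1 (?n ?B 2) (?n (?n ?B 2) 1)"
    using nbr_flag_nbr base_in_flags fl by auto
  then have n: "nbr 1 ?B (?n ?B 1)" "nbr 0 (?n ?B 1) (?s1 ` ?B)"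
    "nbr 2 ?B (?n ?B 2)" "nbr 1 (?n ?B 2) (?s2 ` ?B)"
    using s by simp_all
  \<comment> \<open>On the way from the base flag to its image under \<open>?s1\<close> first the
    edge and then the vertex changes: the 2-face stays throughout, and the edge stays
    changed.\<close>
  have f2: "?s1 c = c" and ne1: "?s1 b \<noteq> b"
  proof -
    obtain x y z where x: "triple x y z" "?n ?B 1 = flag x y z"
      using flag_cases[OF fl(1)] .
    note t1 = aut_triple[OF s(1) t]
    have "nbr 1 (flag a b c) (flag x y z)"
      using n(1) unfolding x(2) unfolding B .
    moreover have "nbr 0 (flag x y z) (flag (?s1 a) (?s1 b) (?s1 c))"
      using n(2) unfolding x(2) unfolding B aut_image_flag[OF s(1)] .
    ultimately have "x = a" "y \<noteq> b" "z = c" "?s1 b = y" "?s1 c = z"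
      unfolding nbr_flag_iff[OF t x(1)] nbr_flag_iff[OF x(1) t1] by simp_all
    then show "?s1 c = c" "?s1 b \<noteq> b" by auto
  qed
  \<comment> \<open>For \<open>?s2\<close> first the 2-face and then the edge changes, so the vertex
    is fixed and the 2-face is moved.\<close>
  have f0: "?s2 a = a" and ne2: "?s2 c \<noteq> c"
  proof -
    obtain x y z where x: "triple x y z" "?n ?B 2 = flag x y z"
      using flag_cases[OF fl(2)] .
    note t1 = aut_triple[OF s(2) t]
    have "nbr 2 (flag a b c) (flag x y z)"
      using n(3) unfolding x(2) unfolding B .
    moreover have "nbr 1 (flag x y z) (flag (?s2 a) (?s2 b) (?s2 c))"
      using n(4) unfolding x(2) unfolding B aut_image_flag[OF s(2)] .
    ultimately have "x = a" "y = b" "z \<noteq> c" "?s2 a = x" "?s2 c = z"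
      unfolding nbr_flag_iff[OF t x(1)] nbr_flag_iff[OF x(1) t1] by simp_all
    then show "?s2 a = a" "?s2 c \<noteq> c" by auto
  qed
  note f = triple_faces[OF t]
  show ?thesis
  proof (intro rotation_pair.intro rotation_pair_axioms.intro)
    show "group ?R"
      using A.subgroup_imp_group[OF Rsub] Req by metis
    show "?s1 \<in> carrier ?R" "?s2 \<in> carrier ?R"
      by (fact sR)+
    show "?s1 \<noteq> \<one>\<^bsub>?R\<^esub>" "?s2 \<noteq> \<one>\<^bsub>?R\<^esub>"
      using ne1 ne2 aut_one_apply[OF f(2)] aut_one_apply[OF f(3)] unfolding ops by metis+
    \<comment> \<open>In the product the two changes of edge cancel, so \<open>?t\<close> sends the
      base flag to the 0-neighbour of its 2-neighbour. A second application undoes both changes,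
      because these neighbour maps commute.\<close>
    let ?t = "?s1 \<otimes>\<^bsub>\<Gamma>\<^esub> ?s2"
    have tc: "?t \<in> carrier \<Gamma>" using s by simp
    have "?t ` ?B = ?s2 ` ?n (?n ?B 1) 0"
      using s by (simp add: aut_mult_image[OF sub])
    also have "\<dots> = ?n (?n (?s2 ` ?B) 1) 0"
      using aut_flag_nbr[OF s(2)] base_in_flags fl by simp
    also have "\<dots> = ?n (?n ?B 2) 0"
      using s flag_nbr_invol[OF fl(2), of 1] by simp
    finally have tB: "?t ` ?B = ?n (?n ?B 2) 0" .
    have "(?t \<otimes>\<^bsub>\<Gamma>\<^esub> ?t) ` ?B = ?t ` ?n (?n ?B 2) 0"
      using tB by (simp only: aut_mult_image[OF sub])
    also have "\<dots> = ?n (?n (?t ` ?B) 2) 0"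
      using aut_flag_nbr[OF tc] base_in_flags fl by simp
    also have "\<dots> = ?n (?n (?n (?n ?B 2) 2) 0) 0"
      unfolding tB using flag_nbr_0_2_commute[OF fl(2)] by simp
    also have "\<dots> = ?B"
      using flag_nbr_invol base_in_flags by simp
    finally show "?s1 \<otimes>\<^bsub>?R\<^esub> ?s2 \<otimes>\<^bsub>?R\<^esub> (?s1 \<otimes>\<^bsub>?R\<^esub> ?s2) = \<one>\<^bsub>?R\<^esub>"
      unfolding ops using tc base_in_flags by (intro aut_fix_flag_imp_one) auto
    show "generate ?R {?s1} \<inter> generate ?R {?s2} \<subseteq> {\<one>\<^bsub>?R\<^esub>}"
    proof
      fix \<gamma> assume \<gamma>: "\<gamma> \<in> generate ?R {?s1} \<inter> generate ?R {?s2}"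
      then have g: "\<gamma> \<in> generate \<Gamma> {?s1}" "\<gamma> \<in> generate \<Gamma> {?s2}"
        using gen sR by auto
      have \<gamma>c: "\<gamma> \<in> carrier \<Gamma>"
        using g A.generate_in_carrier[of "{?s1}" \<gamma>] s by simp
      have \<gamma>R: "\<gamma> \<in> carrier ?R"
        using g A.generate_subgroup_incl[OF _ Rsub, of "{?s1}"] sR by auto
      \<comment> \<open>The group generated by \<open>?s1\<close> lies in the stabiliser of the base
        2-face, and the one generated by \<open>?s2\<close> in that of the base vertex.\<close>
      have "\<gamma> c = c"
        using g A.generate_subgroup_incl[OF _ fixing_subgroup[OF f(3)], of "{?s1}"] f2 s by auto
      moreover have "\<gamma> a = a"
        using g A.generate_subgroup_incl[OF _ fixing_subgroup[OF f(1)], of "{?s2}"] f0 s by auto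
      ultimately have \<gamma>B: "\<gamma> ` ?B = flag a (\<gamma> b) c" and t': "triple a (\<gamma> b) c"
        using aut_image_flag[OF \<gamma>c] aut_triple[OF \<gamma>c t] unfolding B by auto
      have "\<gamma> b = b"
      proof (rule ccontr)
        assume "\<gamma> b \<noteq> b"
        then have "nbr 1 ?B (flag a (\<gamma> b) c)"
          unfolding B using nbr_flag_iff(2)[OF t t'] by simp
        then show False
          using no_refl[OF \<gamma>R] flag_nbr_eq \<gamma>B by auto
      qed
      then have "\<gamma> ` ?B = ?B"
        using \<gamma>B B by simp
      then show "\<gamma> \<in> {\<one>\<^bsub>?R\<^esub>}"
        unfolding ops using aut_fix_flag_imp_one[OF \<gamma>c base_in_flags] by simp
    qed
  qed
qed

end

section \<open>The coset poset of a rotation pair\<close>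

text \<open>Generation of the whole group by the two elements makes each improper rank a single
  coset, and it is the source of connectedness.\<close>

locale rotation_pair_poset = rotation_pair G "\<sigma> 1" "\<sigma> 2"
  for G :: "('g, 'm) monoid_scheme" (structure) and \<sigma> :: "int \<Rightarrow> 'g" +
  assumes carrier_eq: "carrier G = generate G {\<sigma> 1, \<sigma> 2}"
begin

abbreviation K where "K \<equiv> face_subgroup 3 G \<sigma>"

abbreviation t where "t \<equiv> \<sigma> 1 \<otimes> \<sigma> 2"

abbreviation cpos where "cpos \<equiv> coset_poset 3 G \<sigma>"

text \<open>Faces are named by representatives, because incidence then becomes the existence of a
  common representative.\<close>

definition face :: "int \<Rightarrow> 'g \<Rightarrow> int \<times> 'g set" where
  "face j g = (j, K j #> g)"

text \<open>Removing 0 or 2 from the index set leaves one generator, removing 1 leaves only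
  \<open>t\<close>, whose square is \<open>\<one>\<close>. For any other \<open>j\<close> nothing is
  removed and both generators remain.\<close>

lemma face_subgroup_eq:
  "K 0 = generate G {\<sigma> 2}"
  "K 1 = {\<one>, t}"
  "K 2 = generate G {\<sigma> 1}"
  "j \<notin> {0, 1, 2} \<Longrightarrow> K j = carrier G"
proof -
  have up: "[1..2] = [1, 2::int]"
    by (simp add: upto.simps)
  have tau: "tau G \<sigma> 1 1 = \<sigma> 1" "tau G \<sigma> 2 2 = \<sigma> 2" "tau G \<sigma> 1 2 = t"
    by (simp_all add: tau_def up)
  have "i \<le> k \<and> i - 1 \<in> {0..int 3 - 1} - {0} \<and> k \<in> {0..int 3 - 1} - {0} \<longleftrightarrow> i = 2 \<and> k = 2" for i k
    by auto
  then show "K 0 = generate G {\<sigma> 2}"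
    by (simp add: face_subgroup_def gen_subgroup_def tau)
  have "i \<le> k \<and> i - 1 \<in> {0..int 3 - 1} - {2} \<and> k \<in> {0..int 3 - 1} - {2} \<longleftrightarrow> i = 1 \<and> k = 1" for i k
    by auto
  then show "K 2 = generate G {\<sigma> 1}"
    by (simp add: face_subgroup_def gen_subgroup_def tau)
  have "i \<le> k \<and> i - 1 \<in> {0..int 3 - 1} - {1} \<and> k \<in> {0..int 3 - 1} - {1} \<longleftrightarrow> i = 1 \<and> k = 2" for i k
    by auto
  then have "K 1 = generate G {t}"
    by (simp add: face_subgroup_def gen_subgroup_def tau)
  moreover have "subgroup {\<one>, t} G"
    using s1_s2_invol inv_equality[of t t] by unfold_locales auto
  then have "generate G {t} \<subseteq> {\<one>, t}"
    by (intro generate_subgroup_incl) auto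
  then have "generate G {t} = {\<one>, t}"
    by (auto intro: generate.intros)
  ultimately show "K 1 = {\<one>, t}"
    by simp
  show "K j = carrier G" if j: "j \<notin> {0, 1, 2}"
  proof -
    have "i \<le> k \<and> i - 1 \<in> {0..int 3 - 1} - {j} \<and> k \<in> {0..int 3 - 1} - {j} \<longleftrightarrow>
        i = 1 \<and> k = 1 \<or> i = 1 \<and> k = 2 \<or> i = 2 \<and> k = 2" for i k
      using j by auto
    moreover have "{tau G \<sigma> i k | i k. i = 1 \<and> k = 1 \<or> i = 1 \<and> k = 2 \<or> i = 2 \<and> k = 2} =
        {tau G \<sigma> 1 1, tau G \<sigma> 1 2, tau G \<sigma> 2 2}"
      by blast
    ultimately have K: "K j = generate G {\<sigma> 1, t, \<sigma> 2}"
      by (simp add: face_subgroup_def gen_subgroup_def tau)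
    have "generate G {\<sigma> 1, \<sigma> 2} \<subseteq> K j"
      unfolding K by (intro mono_generate) auto
    moreover have "K j \<subseteq> carrier G"
      unfolding K by (intro generate_incl) auto
    ultimately show ?thesis
      using carrier_eq by simp
  qed
qed

lemma subgroup_face_subgroup: "subgroup (K j) G"
proof -
  have "subgroup {\<one>, t} G"
    using s1_s2_invol inv_equality[of t t] by unfold_locales auto
  moreover have "subgroup (generate G {\<sigma> 1}) G" "subgroup (generate G {\<sigma> 2}) G"
    by (simp_all add: generate_is_subgroup)
  ultimately show ?thesis
    using face_subgroup_eq subgroup_self by (cases "j \<in> {0, 1, 2}") auto
qed

lemma s2_in_K0: "\<sigma> 2 \<in> K 0" and s1_in_K2: "\<sigma> 1 \<in> K 2" and t_in_K1: "t \<in> K 1"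
  by (auto simp: face_subgroup_eq intro: generate.incl)

lemma K0_inter_K2: "x \<in> K 0 \<Longrightarrow> x \<in> K 2 \<Longrightarrow> x = \<one>"
  using generate_inter by (auto simp: face_subgroup_eq)

lemma K_closed: "x \<in> K j \<Longrightarrow> x \<in> carrier G"
  using subgroup.subset[OF subgroup_face_subgroup] by blast

text \<open>Otherwise \<open>\<sigma> 1 = t \<otimes> inv (\<sigma> 2)\<close> would lie in both
  cyclic groups. This keeps the two vertices of an edge distinct; \<open>t_notin_K2\<close> does the
  same for the two 2-faces at an edge, and \<open>s1_notin_K1\<close> for the two edges between a
  vertex and a 2-face.\<close>

lemma t_notin_K0: "t \<notin> K 0"
proof
  assume "t \<in> K 0"
  then have "t \<otimes> inv (\<sigma> 2) \<in> K 0"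
    using subgroup.m_closed subgroup.m_inv_closed subgroup_face_subgroup s2_in_K0 by metis
  then have "\<sigma> 1 \<in> K 0"
    by (simp add: m_assoc)
  then show False
    using K0_inter_K2 s1_in_K2 s1_ne_one by blast
qed

lemma t_notin_K2: "t \<notin> K 2"
proof
  assume "t \<in> K 2"
  then have "inv (\<sigma> 1) \<otimes> t \<in> K 2"
    using subgroup.m_closed subgroup.m_inv_closed subgroup_face_subgroup s1_in_K2 by metis
  then have "\<sigma> 2 \<in> K 2"
    by (simp flip: m_assoc)
  then show False
    using K0_inter_K2 s2_in_K0 s2_ne_one by blast
qed

lemma s1_notin_K1: "\<sigma> 1 \<notin> K 1"
  using s1_ne_one s2_ne_one r_cancel_one'[of "\<sigma> 1" "\<sigma> 2"] by (auto simp: face_subgroup_eq)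

section \<open>Incidence through common representatives\<close>

lemma face_mult: "h \<in> K j \<Longrightarrow> g \<in> carrier G \<Longrightarrow> face j (h \<otimes> g) = face j g"
  unfolding face_def
  using coset_mult_assoc[of "K j" h g] coset_join2[of h "K j"] subgroup_face_subgroup K_closed
    subgroup.subset by (metis)

lemma face_eq_imp:
  assumes "face j x = face j y" "x \<in> carrier G" "y \<in> carrier G"
  obtains h where "h \<in> K j" "x = h \<otimes> y"
proof -
  have "x \<in> K j #> x"
    using rcos_self[OF assms(2) subgroup_face_subgroup] .
  then have "x \<in> K j #> y"
    using assms(1) by (simp add: face_def)
  then show thesis
    using that by (auto simp: r_coset_def)
qed

lemma face_mult_eq_iff: "h \<in> carrier G \<Longrightarrow> g \<in> carrier G \<Longrightarrow> face j (h \<otimes> g) = face j g \<longleftrightarrow> h \<in> K j"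
  by (metis face_mult face_eq_imp[of j "h \<otimes> g" g] K_closed m_closed right_cancel)

lemma face_improper: "j \<notin> {0, 1, 2} \<Longrightarrow> x \<in> carrier G \<Longrightarrow> face j x = (j, carrier G)"
  using coset_join2[OF _ subgroup_self] by (simp add: face_def face_subgroup_eq)

lemma fst_face [simp]: "fst (face j x) = j"
  by (simp add: face_def)

lemma face_eq_rank: "face i x = face j y \<Longrightarrow> i = j"
  by (simp add: face_def)

lemma faces_cpos: "faces cpos = {face j g | j g. j \<in> {-1..3} \<and> g \<in> carrier G}"
  by (auto simp: coset_poset_def coset_faces_def RCOSETS_def face_def)

lemma face_in_faces: "j \<in> {-1..3} \<Longrightarrow> g \<in> carrier G \<Longrightarrow> face j g \<in> faces cpos"
  unfolding faces_cpos by blast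

lemma rank_cpos [simp]: "rank cpos F = fst F"
  by (simp add: coset_poset_def)

text \<open>Cosets that meet can both be rewritten with a common element as representative. Order
  properties then amount to finding such elements.\<close>

lemma le_cpos_iff:
  "(F, H) \<in> le cpos \<longleftrightarrow>
    (\<exists>i j x. i \<in> {-1..3} \<and> j \<in> {-1..3} \<and> i \<le> j \<and> x \<in> carrier G \<and> F = face i x \<and> H = face j x)"
proof
  assume "(F, H) \<in> le cpos"
  then have FH: "F \<in> faces cpos" "H \<in> faces cpos" "fst F \<le> fst H" "snd F \<inter> snd H \<noteq> {}"
    by (auto simp: coset_poset_def)
  then obtain i g j h where F: "F = face i g" "i \<in> {-1..3}" "g \<in> carrier G"
    and H: "H = face j h" "j \<in> {-1..3}" "h \<in> carrier G"
    by (auto simp: faces_cpos)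
  obtain x where x: "x \<in> K i #> g" "x \<in> K j #> h"
    using FH(4) F(1) H(1) by (auto simp: face_def)
  then have "x \<in> carrier G"
    using r_coset_subset_G[OF subgroup.subset[OF subgroup_face_subgroup] F(3)] by blast
  moreover have "F = face i x" "H = face j x"
    using repr_independence[OF x(1) F(3) subgroup_face_subgroup]
      repr_independence[OF x(2) H(3) subgroup_face_subgroup] F(1) H(1) by (auto simp: face_def)
  ultimately show "\<exists>i j x. i \<in> {-1..3} \<and> j \<in> {-1..3} \<and> i \<le> j \<and> x \<in> carrier G \<and> F = face i x \<and> H = face j x"
    using F(2) H(2) FH(3) by (intro exI[of _ i] exI[of _ j] exI[of _ x]) auto
next
  assume "\<exists>i j x. i \<in> {-1..3} \<and> j \<in> {-1..3} \<and> i \<le> j \<and> x \<in> carrier G \<and> F = face i x \<and> H = face j x"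
  then obtain i j x where *: "i \<in> {-1..3}" "j \<in> {-1..3}" "i \<le> j" "x \<in> carrier G" "F = face i x" "H = face j x"
    by blast
  have "x \<in> K i #> x" "x \<in> K j #> x"
    using rcos_self[OF *(4) subgroup_face_subgroup] by auto
  then show "(F, H) \<in> le cpos"
    using * by (auto simp: coset_poset_def coset_faces_def face_def RCOSETS_def)
qed

lemma face_le: "x \<in> carrier G \<Longrightarrow> i \<in> {-1..3} \<Longrightarrow> j \<in> {-1..3} \<Longrightarrow> i \<le> j \<Longrightarrow> (face i x, face j x) \<in> le cpos"
  unfolding le_cpos_iff by (intro exI[of _ i] exI[of _ j] exI[of _ x]) simp

lemma le_cposE:
  assumes "(F, H) \<in> le cpos"
  obtains x where "x \<in> carrier G" "F = face (fst F) x" "H = face (fst H) x"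
    "fst F \<in> {-1..3}" "fst H \<in> {-1..3}"
  using assms unfolding le_cpos_iff by (elim exE conjE) simp

text \<open>If the edge of \<open>x\<close> is also the edge of \<open>y = t x\<close>, then \<open>\<sigma>\<^sub>2 x\<close> lies in the vertex of \<open>x\<close> and,
  since \<open>t = \<sigma>\<^sub>1 \<sigma>\<^sub>2\<close>, in the 2-face of \<open>y\<close>.\<close>

lemma vertex_face_of_common_edge:
  assumes "x \<in> carrier G" "y \<in> carrier G" "face 1 x = face 1 y"
  obtains "x = y" | "y = t \<otimes> x" "face 0 x = face 0 (\<sigma> 2 \<otimes> x)" "face 2 y = face 2 (\<sigma> 2 \<otimes> x)"
    "face 1 x = face 1 (\<sigma> 1 \<otimes> (\<sigma> 2 \<otimes> x))"
proof -
  obtain h where h: "h \<in> K 1" "y = h \<otimes> x"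
    using face_eq_imp[of 1 y x] assms by metis
  then consider "h = \<one>" | "h = t"
    by (auto simp: face_subgroup_eq)
  then show thesis
  proof cases
    case 1
    then show thesis using that(1) h assms by simp
  next
    case 2
    have "face 2 y = face 2 (\<sigma> 2 \<otimes> x)"
      using face_mult[OF s1_in_K2, of "\<sigma> 2 \<otimes> x"] h 2 assms by (simp add: m_assoc)
    moreover have "face 0 x = face 0 (\<sigma> 2 \<otimes> x)"
      using face_mult[OF s2_in_K0] assms by simp
    moreover have "face 1 x = face 1 (\<sigma> 1 \<otimes> (\<sigma> 2 \<otimes> x))"
      using assms 2 h by (simp add: m_assoc)
    ultimately show thesis
      using that(2) h 2 by blast
  qed
qed

lemma le_cpos_trans:
  assumes "(F, H) \<in> le cpos" "(H, J) \<in> le cpos"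
  shows "(F, J) \<in> le cpos"
proof -
  obtain i j x where 1: "i \<in> {-1..3}" "j \<in> {-1..3}" "i \<le> j" "x \<in> carrier G" "F = face i x" "H = face j x"
    using assms(1) unfolding le_cpos_iff by blast
  obtain j' k y where 2: "j' \<in> {-1..3}" "k \<in> {-1..3}" "j' \<le> k" "y \<in> carrier G" "H = face j' y" "J = face k y"
    using assms(2) unfolding le_cpos_iff by blast
  have jj: "j' = j"
    using 1 2 face_eq_rank by metis
  note 2 = 2[unfolded jj]
  \<comment> \<open>A common representative of the outer faces is wanted. With equal ranks or
    improper faces \<open>x\<close> or \<open>y\<close> serves at once; for ranks 0, 1, 2 it is
    \<open>\<sigma> 2 \<otimes> x\<close>, unless \<open>x = y\<close>.\<close>
  have "\<exists>z \<in> carrier G. face i x = face i z \<and> face k y = face k z"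
  proof -
    consider "i = j" | "j = k" | "i = -1" | "k = 3" | "i = 0" "j = 1" "k = 2"
      using 1 2 by fastforce
    then show ?thesis
    proof cases
      case 1
      then show ?thesis using \<open>y \<in> carrier G\<close> \<open>H = face j x\<close> \<open>H = face j y\<close> by (intro bexI[of _ y]) auto
    next
      case 2
      then show ?thesis using \<open>x \<in> carrier G\<close> \<open>H = face j x\<close> \<open>H = face j y\<close> by (intro bexI[of _ x]) auto
    next
      case 3
      then show ?thesis using \<open>x \<in> carrier G\<close> \<open>y \<in> carrier G\<close> face_improper[of "-1"] by (intro bexI[of _ y]) auto
    next
      case 4
      then show ?thesis using \<open>x \<in> carrier G\<close> \<open>y \<in> carrier G\<close> face_improper[of 3] by (intro bexI[of _ x]) auto
    next
      case 5
      have xy: "x \<in> carrier G" "y \<in> carrier G" and "face 1 x = face 1 y"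
        using 1 2 5 by auto
      then show ?thesis
      proof (cases rule: vertex_face_of_common_edge)
        case 1
        then show ?thesis using xy by auto
      next
        case 2
        then show ?thesis using xy 5 by (intro bexI[of _ "\<sigma> 2 \<otimes> x"]) auto
      qed
    qed
  qed
  then obtain z where z: "z \<in> carrier G" "face i x = face i z" "face k y = face k z"
    by blast
  have "i \<le> k"
    using 1(3) 2(3) by simp
  then show ?thesis
    unfolding le_cpos_iff using 1(1,5) 2(2,6) z
    by (intro exI[of _ i] exI[of _ k] exI[of _ z]) simp
qed

sublocale R: ranked_poset3 cpos "(-1, carrier G)" "(3, carrier G)"
proof
  have po: "partial_order_on (faces cpos) (le cpos)"
    unfolding partial_order_on_def preorder_on_def
  proof (intro conjI)
    show "le cpos \<subseteq> faces cpos \<times> faces cpos"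
      by (auto simp: coset_poset_def)
    show "refl_on (faces cpos) (le cpos)"
      by (auto simp: refl_on_def le_cpos_iff faces_cpos)
    show "trans (le cpos)"
      using le_cpos_trans by (rule transI)
    show "antisym (le cpos)"
    proof (rule antisymI)
      fix F H assume a: "(F, H) \<in> le cpos" "(H, F) \<in> le cpos"
      obtain i j x where 1: "i \<le> j" "F = face i x" "H = face j x"
        using a(1) unfolding le_cpos_iff by blast
      have "fst H \<le> fst F"
        using a(2) unfolding le_cpos_iff by auto
      then show "F = H"
        using 1 by simp
    qed
  qed
  have "fst F < fst H" if sb: "strictly_below cpos F H" for F H
  proof -
    obtain i j x where ij: "i \<le> j" "F = face i x" "H = face j x" "F \<noteq> H"
      using sb unfolding strictly_below_def le_cpos_iff by blast
    then have "i \<noteq> j" by blast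
    then show ?thesis using ij by simp
  qed
  moreover have "rank cpos F \<in> {-1..int 3}" if "F \<in> faces cpos" for F
    using that unfolding faces_cpos by auto
  ultimately show "ranked_poset 3 cpos"
    using po by (simp add: ranked_poset_def)
  have imp: "(-1, carrier G) = face (-1) x" "(3, carrier G) = face 3 x" if "x \<in> carrier G" for x
    using face_improper[of "-1" x] face_improper[of 3 x] that by auto
  show "(-1, carrier G) \<in> faces cpos" "(3, carrier G) \<in> faces cpos"
    using imp[of \<one>] face_in_faces[of "-1" \<one>] face_in_faces[of 3 \<one>] by simp_all
  show "rank cpos (-1, carrier G) = -1" "rank cpos (3, carrier G) = 3"
    by simp_all
  fix F assume "F \<in> faces cpos"
  then obtain j g where "F = face j g" "j \<in> {-1..3}" "g \<in> carrier G"
    by (auto simp: faces_cpos)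
  then show "((-1, carrier G), F) \<in> le cpos" "(F, (3, carrier G)) \<in> le cpos"
    using imp[of g] face_le[of g "-1" j] face_le[of g j 3] by simp_all
qed

text \<open>\<open>flg False g\<close> consists of the faces containing \<open>g\<close>, and \<open>flg True g\<close> is its 1-adjacent flag.\<close>

definition flg :: "bool \<Rightarrow> 'g \<Rightarrow> (int \<times> 'g set) set" where
  "flg e g = R.flag (face 0 g) (face 1 (if e then \<sigma> 1 \<otimes> g else g)) (face 2 g)"

section \<open>Flags of the coset poset\<close>

lemma face_s2: "g \<in> carrier G \<Longrightarrow> face 0 (\<sigma> 2 \<otimes> g) = face 0 g"
  by (rule face_mult[OF s2_in_K0])

lemma face_s1: "g \<in> carrier G \<Longrightarrow> face 2 (\<sigma> 1 \<otimes> g) = face 2 g"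
  by (rule face_mult[OF s1_in_K2])

lemma face_s1_s2: "g \<in> carrier G \<Longrightarrow> face 1 (\<sigma> 1 \<otimes> (\<sigma> 2 \<otimes> g)) = face 1 g"
  using face_mult[OF t_in_K1, of g] by (simp add: m_assoc)

lemma triple_flg:
  assumes "g \<in> carrier G"
  shows "R.triple (face 0 g) (face 1 (if e then \<sigma> 1 \<otimes> g else g)) (face 2 g)"
proof (cases e)
  case False
  then show ?thesis
    using assms face_le by (simp add: R.triple_def)
next
  case True
  \<comment> \<open>This element shares its vertex with \<open>g\<close>, as
    \<open>\<sigma> 2 \<otimes> ?x = g\<close>. Its edge is that of
    \<open>\<sigma> 1 \<otimes> g = t \<otimes> ?x\<close>, as \<open>t\<close> lies in
    \<open>K 1\<close>.\<close>
  let ?x = "inv (\<sigma> 2) \<otimes> g"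
  have x: "?x \<in> carrier G" "\<sigma> 2 \<otimes> ?x = g"
    using assms by (simp_all flip: m_assoc)
  have "face 0 g = face 0 ?x" "face 1 (\<sigma> 1 \<otimes> g) = face 1 ?x"
    using face_s2[OF x(1)] face_s1_s2[OF x(1)] by (simp_all add: x(2))
  then have "(face 0 g, face 1 (\<sigma> 1 \<otimes> g)) \<in> le cpos"
    using face_le[OF x(1), of 0 1] by simp
  moreover have "(face 1 (\<sigma> 1 \<otimes> g), face 2 g) \<in> le cpos"
    using face_le[of "\<sigma> 1 \<otimes> g" 1 2] face_s1[OF assms] assms by simp
  ultimately show ?thesis
    using True by (simp add: R.triple_def)
qed

text \<open>Vertex and edge have a common representative \<open>x\<close>, edge and 2-face a common
  \<open>y\<close>. As \<open>K 1\<close> consists of \<open>\<one>\<close> and \<open>t\<close>,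
  either \<open>x = y\<close> and the flag is \<open>flg False x\<close>, or
  \<open>y = t \<otimes> x\<close> and it is
  \<open>flg True (\<sigma> 2 \<otimes> x)\<close>.\<close>

lemma triple_cases:
  assumes "R.triple a b c"
  obtains e g where "g \<in> carrier G" "a = face 0 g" "b = face 1 (if e then \<sigma> 1 \<otimes> g else g)" "c = face 2 g"
proof -
  have "(a, b) \<in> le cpos" "(b, c) \<in> le cpos" and r: "fst a = 0" "fst b = 1" "fst c = 2"
    using assms by (auto simp: R.triple_def)
  then obtain x y where x: "x \<in> carrier G" "a = face 0 x" "b = face 1 x"
    and y: "y \<in> carrier G" "b = face 1 y" "c = face 2 y"
    by (metis le_cposE)
  have eq: "face 1 x = face 1 y"
    using x y by simp
  from x(1) y(1) eq show thesis
  proof (cases rule: vertex_face_of_common_edge)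
    case 1
    then show thesis
      using that[of x False] x y by simp
  next
    case 2
    then show thesis
      using that[of "\<sigma> 2 \<otimes> x" True] x y by simp
  qed
qed

text \<open>If one of the ranks 0, 1, 2 is missing, at most two proper faces remain, and these have
  a common representative. So every chain lies in a five-element one, and maximality forces
  equality.\<close>

lemma card_flags_cpos:
  assumes "\<Phi> \<in> flags cpos"
  shows "card \<Phi> = 5"
proof -
  have ch: "\<Phi> \<in> Chains (le cpos)" and max: "\<And>C. C \<in> Chains (le cpos) \<Longrightarrow> \<Phi> \<subseteq> C \<Longrightarrow> C = \<Phi>"
    using assms by (auto simp: flags_def)
  have sub: "\<Phi> \<subseteq> faces cpos"
    using R.chain_subset_faces[OF ch] .
  have inj: "F = H" if "F \<in> \<Phi>" "H \<in> \<Phi>" "fst F = fst H" for F H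
    using R.chain_rank_inj[OF ch] that by (auto simp: inj_on_def)
  have le: "(F, H) \<in> le cpos" if FH: "F \<in> \<Phi>" "H \<in> \<Phi>" "fst F < fst H" for F H
  proof -
    have "(F, H) \<in> le cpos \<or> (H, F) \<in> le cpos"
      using ch FH(1,2) unfolding Chains_def by blast
    moreover have "(H, F) \<notin> le cpos"
      using FH(3) R.rank_less[of H F] by auto
    ultimately show ?thesis by simp
  qed
  have "\<exists>a b c. R.triple a b c \<and> (\<forall>F \<in> \<Phi>. (fst F = 0 \<longrightarrow> F = a) \<and> (fst F = 1 \<longrightarrow> F = b) \<and> (fst F = 2 \<longrightarrow> F = c))"
  proof (cases "{0, 1, 2} \<subseteq> fst ` \<Phi>")
    case True
    then obtain a b c where abc: "a \<in> \<Phi>" "b \<in> \<Phi>" "c \<in> \<Phi>" "fst a = 0" "fst b = 1" "fst c = 2"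
      by (metis (no_types, lifting) imageE insert_subset)
    then have "R.triple a b c"
      using le by (simp add: R.triple_def)
    moreover have "\<forall>F \<in> \<Phi>. (fst F = 0 \<longrightarrow> F = a) \<and> (fst F = 1 \<longrightarrow> F = b) \<and> (fst F = 2 \<longrightarrow> F = c)"
      using inj abc by metis
    ultimately show ?thesis by blast
  next
    case False
    then obtain j where j: "j \<in> {0, 1, 2}" "j \<notin> fst ` \<Phi>"
      by blast
    \<comment> \<open>A rank absent from \<open>\<Phi>\<close> imposes nothing: a representative of
      the other face serves, or \<open>\<one>\<close> if both are absent.\<close>
    have two: "\<exists>x \<in> carrier G. \<forall>F \<in> \<Phi>. (fst F = p \<longrightarrow> F = face p x) \<and> (fst F = q \<longrightarrow> F = face q x)"
      if pq: "p < q" for p q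
    proof -
      have single: "\<exists>x \<in> carrier G. F = face (fst F) x" if F: "F \<in> \<Phi>" for F
      proof -
        obtain j x where "F = face j x" "x \<in> carrier G"
          using F sub unfolding faces_cpos by blast
        then show ?thesis by auto
      qed
      consider A B where "A \<in> \<Phi>" "B \<in> \<Phi>" "fst A = p" "fst B = q"
        | "\<forall>F \<in> \<Phi>. fst F \<noteq> p" | "\<forall>F \<in> \<Phi>. fst F \<noteq> q"
        by blast
      then show ?thesis
      proof cases
        case 1
        then have "(A, B) \<in> le cpos"
          using le pq by simp
        then obtain x where x: "x \<in> carrier G" "A = face p x" "B = face q x"
          using 1(3,4) le_cposE by metis
        have "\<forall>F \<in> \<Phi>. (fst F = p \<longrightarrow> F = face p x) \<and> (fst F = q \<longrightarrow> F = face q x)"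
          using inj 1 x by metis
        then show ?thesis using x(1) by blast
      next
        case 2
        show ?thesis
        proof (cases "\<exists>B \<in> \<Phi>. fst B = q")
          case True
          then obtain B where B: "B \<in> \<Phi>" "fst B = q" by blast
          then obtain x where "x \<in> carrier G" "B = face q x"
            using single by metis
          then show ?thesis
            using 2 B inj by metis
        next
          case False
          then show ?thesis
            using 2 one_closed by metis
        qed
      next
        case 3
        show ?thesis
        proof (cases "\<exists>B \<in> \<Phi>. fst B = p")
          case True
          then obtain B where B: "B \<in> \<Phi>" "fst B = p" by blast
          then obtain x where "x \<in> carrier G" "B = face p x"
            using single by metis
          then show ?thesis
            using 3 B inj by metis
        next
          case False
          then show ?thesis
            using 3 one_closed by metis
        qed
      qed
    qed
    have "\<exists>x \<in> carrier G. \<forall>F \<in> \<Phi>. (fst F = 0 \<longrightarrow> F = face 0 x) \<and> (fst F = 1 \<longrightarrow> F = face 1 x) \<and> (fst F = 2 \<longrightarrow> F = face 2 x)"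
    proof -
      have nj: "fst F \<noteq> j" if "F \<in> \<Phi>" for F
        using j(2) that by blast
      consider "j = 0" | "j = 1" | "j = 2"
        using j(1) by blast
      then show ?thesis
      proof cases
        case 1
        obtain x where "x \<in> carrier G" "\<forall>F \<in> \<Phi>. (fst F = 1 \<longrightarrow> F = face 1 x) \<and> (fst F = 2 \<longrightarrow> F = face 2 x)"
          using two[of 1 2] by auto
        then show ?thesis using nj 1 by (intro bexI[of _ x]) auto
      next
        case 2
        obtain x where "x \<in> carrier G" "\<forall>F \<in> \<Phi>. (fst F = 0 \<longrightarrow> F = face 0 x) \<and> (fst F = 2 \<longrightarrow> F = face 2 x)"
          using two[of 0 2] by auto
        then show ?thesis using nj 2 by (intro bexI[of _ x]) auto
      next
        case 3
        obtain x where "x \<in> carrier G" "\<forall>F \<in> \<Phi>. (fst F = 0 \<longrightarrow> F = face 0 x) \<and> (fst F = 1 \<longrightarrow> F = face 1 x)"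
          using two[of 0 1] by auto
        then show ?thesis using nj 3 by (intro bexI[of _ x]) auto
      qed
    qed
    then obtain x where x: "x \<in> carrier G" "\<forall>F \<in> \<Phi>. (fst F = 0 \<longrightarrow> F = face 0 x) \<and> (fst F = 1 \<longrightarrow> F = face 1 x) \<and> (fst F = 2 \<longrightarrow> F = face 2 x)"
      by blast
    show ?thesis
      using triple_flg[OF x(1), of False] x(2)
      by (intro exI[of _ "face 0 x"] exI[of _ "face 1 x"] exI[of _ "face 2 x"]) simp
  qed
  then obtain a b c where tr: "R.triple a b c"
    and abc: "\<forall>F \<in> \<Phi>. (fst F = 0 \<longrightarrow> F = a) \<and> (fst F = 1 \<longrightarrow> F = b) \<and> (fst F = 2 \<longrightarrow> F = c)"
    by (elim exE conjE) (rule that)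
  have "\<Phi> \<subseteq> R.flag a b c"
  proof
    fix F assume F: "F \<in> \<Phi>"
    then obtain j x where jx: "F = face j x" "j \<in> {-1..3}" "x \<in> carrier G"
      using sub by (auto simp: faces_cpos)
    then consider "j = -1" | "j = 0" | "j = 1" | "j = 2" | "j = 3"
      by fastforce
    then show "F \<in> R.flag a b c"
    proof cases
      case 1
      then show ?thesis using jx face_improper[of "-1"] by (simp add: R.flag_def)
    next
      case 5
      then show ?thesis using jx face_improper[of 3] by (simp add: R.flag_def)
    qed (use abc F jx in \<open>auto simp: R.flag_def\<close>)
  qed
  moreover have "R.flag a b c \<in> Chains (le cpos)"
    using R.flag_in_flags[OF tr] by (simp add: flags_def)
  ultimately have "\<Phi> = R.flag a b c"
    using max by blast
  then show ?thesis
    using R.card_flag[OF tr] by simp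
qed

lemma flg_in_flags: "g \<in> carrier G \<Longrightarrow> flg e g \<in> flags cpos"
  unfolding flg_def by (intro R.flag_in_flags triple_flg)

lemma flags_cpos_cases:
  assumes "\<Phi> \<in> flags cpos"
  obtains e g where "g \<in> carrier G" "\<Phi> = flg e g"
proof -
  have "\<Phi> \<in> Chains (le cpos)"
    using assms by (simp add: flags_def)
  then obtain a b c where abc: "R.triple a b c" "\<Phi> = R.flag a b c"
    using R.chain_card_5_cases card_flags_cpos[OF assms] by blast
  obtain e g where "g \<in> carrier G" "a = face 0 g" "b = face 1 (if e then \<sigma> 1 \<otimes> g else g)" "c = face 2 g"
    using triple_cases[OF abc(1)] .
  then show thesis
    using that[of g e] abc(2) by (simp add: flg_def)
qed

text \<open>The trivial intersection enters here, since \<open>g\<close> and \<open>h\<close> differ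
  by an element of both \<open>K 0\<close> and \<open>K 2\<close>. A group element is thus recovered
  from its vertex and 2-face, whatever the edge.\<close>

lemma face_0_2_inj:
  assumes "g \<in> carrier G" "h \<in> carrier G" "face 0 g = face 0 h" "face 2 g = face 2 h"
  shows "g = h"
proof -
  obtain x where x: "x \<in> K 0" "g = x \<otimes> h"
    using face_eq_imp[OF assms(3,1,2)] .
  then have "x \<in> K 2"
    using assms face_mult_eq_iff[of x h 2] K_closed by simp
  then show ?thesis
    using K0_inter_K2[OF x(1)] x(2) assms(2) by simp
qed

text \<open>The middle faces are those of \<open>x\<close> and \<open>u \<otimes> x\<close>, with
  \<open>u = t\<close> for vertices and 2-faces and \<open>u = \<sigma> 1\<close> for edges; they
  differ because \<open>u\<close> is not in \<open>K j\<close>.\<close>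

lemma diamond_cpos: "diamond_condition cpos"
  unfolding diamond_condition_def
proof (intro allI impI, elim conjE)
  fix F H j
  assume sb: "strictly_below cpos F H" and r: "rank cpos F = j - 1" "rank cpos H = j + 1"
  then obtain x where x: "x \<in> carrier G" "F = face (j - 1) x" "H = face (j + 1) x" "j - 1 \<in> {-1..3}" "j + 1 \<in> {-1..3}"
    unfolding strictly_below_def rank_cpos by (metis le_cposE)
  let ?S = "{E \<in> faces cpos. rank cpos E = j \<and> strictly_below cpos F E \<and> strictly_below cpos E H}"
  have S: "E \<in> ?S \<longleftrightarrow> fst E = j \<and> (F, E) \<in> le cpos \<and> (E, H) \<in> le cpos" for E
    using r R.le_in_faces(1)[of E H] by (auto simp: strictly_below_def)
  have tx: "face 1 (t \<otimes> x) = face 1 x"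
    using face_mult[OF t_in_K1 x(1)] .
  have two: "card ?S = 2" if "?S = {face j x, face j (u \<otimes> x)}" "u \<in> carrier G" "u \<notin> K j" for u
    using that x(1) face_mult_eq_iff[of u x j] by (simp add: card_2_iff)
  consider "j = 0" | "j = 1" | "j = 2"
    using x(4,5) by fastforce
  then show "card ?S = 2"
  proof cases
    case 1
    have "?S = {face j x, face j (t \<otimes> x)}"
    proof (intro equalityI subsetI)
      fix E assume "E \<in> ?S"
      then have "fst E = 0" "(E, H) \<in> le cpos"
        using S 1 by auto
      then obtain y where y: "y \<in> carrier G" "E = face 0 y" "face 1 y = face 1 x"
        using le_cposE[of E H] x(3) 1 by (metis add_0 fst_face)
      obtain h where "h \<in> K 1" "y = h \<otimes> x"
        using face_eq_imp[OF y(3,1) x(1)] .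
      then show "E \<in> {face j x, face j (t \<otimes> x)}"
        using y x 1 by (auto simp: face_subgroup_eq)
    next
      fix E assume "E \<in> {face j x, face j (t \<otimes> x)}"
      moreover have "F = (-1, carrier G)"
        using x face_improper 1 by simp
      ultimately show "E \<in> ?S"
        using face_le[of x 0 1] face_le[of "t \<otimes> x" 0 1] tx x(1,3) 1
          R.least(3)[OF face_in_faces[of 0 x]] R.least(3)[OF face_in_faces[of 0 "t \<otimes> x"]]
        unfolding S by auto
    qed
    then show ?thesis
      using two t_notin_K0 1 by simp
  next
    case 2
    have tr: "E \<in> ?S \<longleftrightarrow> R.triple (face 0 x) E (face 2 x)" for E
      unfolding S using 2 x by (auto simp: R.triple_def)
    have "?S = {face j x, face j (\<sigma> 1 \<otimes> x)}"
    proof (intro equalityI subsetI)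
      fix E assume "E \<in> ?S"
      then have "R.triple (face 0 x) E (face 2 x)"
        by (rule tr[THEN iffD1])
      then obtain e g where g: "g \<in> carrier G" "face 0 x = face 0 g"
        "E = face 1 (if e then \<sigma> 1 \<otimes> g else g)" "face 2 x = face 2 g"
        by (rule triple_cases)
      then have "g = x"
        using face_0_2_inj[OF g(1) x(1)] by simp
      then show "E \<in> {face j x, face j (\<sigma> 1 \<otimes> x)}"
        using g 2 by (cases e) auto
    next
      fix E assume "E \<in> {face j x, face j (\<sigma> 1 \<otimes> x)}"
      then show "E \<in> ?S"
        using triple_flg[OF x(1), of True] triple_flg[OF x(1), of False] 2 unfolding tr by auto
    qed
    then show ?thesis
      using two s1_notin_K1 2 by simp
  next
    case 3
    have "?S = {face j x, face j (t \<otimes> x)}"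
    proof (intro equalityI subsetI)
      fix E assume "E \<in> ?S"
      then have "fst E = 2" "(F, E) \<in> le cpos"
        using S 3 by auto
      then obtain y where y: "y \<in> carrier G" "E = face 2 y" "face 1 y = face 1 x"
        using le_cposE[of F E] x(2) 3 by (metis fst_face diff_numeral_special(11) one_add_one add_diff_cancel)
      obtain h where "h \<in> K 1" "y = h \<otimes> x"
        using face_eq_imp[OF y(3,1) x(1)] .
      then show "E \<in> {face j x, face j (t \<otimes> x)}"
        using y x 3 by (auto simp: face_subgroup_eq)
    next
      fix E assume "E \<in> {face j x, face j (t \<otimes> x)}"
      moreover have "H = (3, carrier G)"
        using x face_improper 3 by simp
      ultimately show "E \<in> ?S"
        using face_le[of x 1 2] face_le[of "t \<otimes> x" 1 2] tx x(1,2) 3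
          R.greatest(3)[OF face_in_faces[of 2 x]] R.greatest(3)[OF face_in_faces[of 2 "t \<otimes> x"]]
        unfolding S by auto
    qed
    then show ?thesis
      using two t_notin_K2 3 by simp
  qed
qed

section \<open>Strong flag-connectedness of the coset poset\<close>

definition flag_step :: "(int \<times> 'g set) set \<Rightarrow> (int \<times> 'g set) set rel" where
  "flag_step X = {(\<Lambda>, \<Lambda>'). \<Lambda> \<in> flags cpos \<and> \<Lambda>' \<in> flags cpos \<and> adjacent \<Lambda> \<Lambda>' \<and> X \<subseteq> \<Lambda> \<and> X \<subseteq> \<Lambda>'}"

lemma flag_steps_sym: "(\<Lambda>, \<Lambda>') \<in> (flag_step X)\<^sup>* \<Longrightarrow> (\<Lambda>', \<Lambda>) \<in> (flag_step X)\<^sup>*"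
proof -
  have "sym (flag_step X)"
    by (auto simp: sym_def flag_step_def adjacent_def)
  then show "(\<Lambda>, \<Lambda>') \<in> (flag_step X)\<^sup>* \<Longrightarrow> (\<Lambda>', \<Lambda>) \<in> (flag_step X)\<^sup>*"
    using sym_rtrancl symD by metis
qed

text \<open>\<open>X\<close> stands for the intersection of the flags to be joined and stays the
  same while paths are composed. The reflexive closure absorbs the case of equal triples.\<close>

lemma flag_step_two_common:
  assumes tr: "R.triple a b c" "R.triple a' b' c'"
    and eq: "b = b' \<and> c = c' \<or> a = a' \<and> c = c' \<or> a = a' \<and> b = b'"
    and X: "X \<subseteq> R.flag a b c" "X \<subseteq> R.flag a' b' c'"
  shows "(R.flag a b c, R.flag a' b' c') \<in> (flag_step X)\<^sup>*"
proof (cases "a = a' \<and> b = b' \<and> c = c'")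
  case True
  then show ?thesis by simp
next
  case False
  then have "adjacent (R.flag a b c) (R.flag a' b' c')"
    unfolding R.adjacent_flag_iff[OF tr] R.nbr_flag_iff[OF tr] using eq by blast
  then have "(R.flag a b c, R.flag a' b' c') \<in> flag_step X"
    using X R.flag_in_flags tr by (simp add: flag_step_def)
  then show ?thesis by blast
qed

text \<open>When \<open>X\<close> has no edge, containment sees only the vertex and 2-face of
  \<open>g\<close>, so paths may switch between the two kinds of flag.\<close>

lemma subset_flg_iff:
  assumes "\<forall>F \<in> X. fst F \<noteq> 1"
  shows "X \<subseteq> flg e g \<longleftrightarrow> X \<subseteq> {(-1, carrier G), face 0 g, face 2 g, (3, carrier G)}"
proof -
  have "face 1 x \<notin> X" for x
    using assms by auto
  then show ?thesis
    unfolding flg_def R.flag_def by blast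
qed

lemma flag_steps_flip:
  assumes "\<forall>F \<in> X. fst F \<noteq> 1" "g \<in> carrier G" "X \<subseteq> flg e g"
  shows "(flg e g, flg e' g) \<in> (flag_step X)\<^sup>*"
proof -
  have "X \<subseteq> flg e' g"
    using assms(3) unfolding subset_flg_iff[OF assms(1)] .
  then show ?thesis
    using assms(3) unfolding flg_def
    by (intro flag_step_two_common triple_flg assms(2)) auto
qed

text \<open>The path passes through a flag of the other kind. For \<open>\<sigma> 1\<close> it is
  \<open>flg True g\<close>, which shares edge and 2-face with the target; for
  \<open>\<sigma> 2\<close> it is \<open>flg True (s \<otimes> g)\<close>, which shares vertex and
  edge with the start.\<close>

lemma flag_steps_generator:
  assumes X: "\<forall>F \<in> X. fst F \<noteq> 1" and g: "g \<in> carrier G" and s: "s \<in> {\<sigma> 1, \<sigma> 2}"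
    and Xg: "X \<subseteq> flg False g" "X \<subseteq> flg False (s \<otimes> g)"
  shows "(flg False g, flg False (s \<otimes> g)) \<in> (flag_step X)\<^sup>*"
proof -
  have sub: "X \<subseteq> flg True g" "X \<subseteq> flg True (s \<otimes> g)"
    using Xg unfolding subset_flg_iff[OF X] .
  have sg: "s \<otimes> g \<in> carrier G"
    using s g by auto
  show ?thesis
  proof (cases "s = \<sigma> 1")
    case True
    have "(flg True g, flg False (s \<otimes> g)) \<in> (flag_step X)\<^sup>*"
      using sub(1) Xg(2) face_s1[OF g] True unfolding flg_def
      by (intro flag_step_two_common triple_flg g sg) auto
    then show ?thesis
      using flag_steps_flip[OF X g Xg(1), of True] by simp
  next
    case False
    then have "s = \<sigma> 2"
      using s by simp
    then have "(flg False g, flg True (s \<otimes> g)) \<in> (flag_step X)\<^sup>*"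
      using sub(2) Xg(1) face_s2[OF g] face_s1_s2[OF g] unfolding flg_def
      by (intro flag_step_two_common triple_flg g sg) auto
    then show ?thesis
      using flag_steps_flip[OF X sg sub(2), of False] by simp
  qed
qed

text \<open>\<open>S\<close> holds generators that do not affect containment of \<open>X\<close>.
  Containment is carried through the induction because a product needs it at the intermediate
  element.\<close>

lemma flag_steps_generate:
  assumes X: "\<forall>F \<in> X. fst F \<noteq> 1" and S: "S \<subseteq> {\<sigma> 1, \<sigma> 2}"
    and inv: "\<And>s g. s \<in> S \<Longrightarrow> g \<in> carrier G \<Longrightarrow> X \<subseteq> flg False (s \<otimes> g) \<longleftrightarrow> X \<subseteq> flg False g"
    and h: "h \<in> generate G S" and g: "g \<in> carrier G" "X \<subseteq> flg False g"
  shows "X \<subseteq> flg False (h \<otimes> g) \<and> (flg False g, flg False (h \<otimes> g)) \<in> (flag_step X)\<^sup>*"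
proof -
  have Sc: "S \<subseteq> carrier G"
    using S by auto
  have "\<forall>g \<in> carrier G. X \<subseteq> flg False g \<longrightarrow>
      X \<subseteq> flg False (h \<otimes> g) \<and> (flg False g, flg False (h \<otimes> g)) \<in> (flag_step X)\<^sup>*"
    using h
  proof (induction rule: generate.induct)
    case one
    then show ?case by simp
  next
    case (incl s)
    show ?case
    proof (intro ballI impI)
      fix g assume g: "g \<in> carrier G" "X \<subseteq> flg False g"
      have "X \<subseteq> flg False (s \<otimes> g)"
        using inv[OF incl g(1)] g(2) by simp
      then show "X \<subseteq> flg False (s \<otimes> g) \<and> (flg False g, flg False (s \<otimes> g)) \<in> (flag_step X)\<^sup>*"
        using flag_steps_generator[OF X g(1) _ g(2)] S incl by blast
    qed
  next
    case (inv s)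
    show ?case
    proof (intro ballI impI)
      fix g assume g: "g \<in> carrier G" "X \<subseteq> flg False g"
      let ?g = "inv s \<otimes> g"
      have s: "s \<in> carrier G"
        using inv Sc by blast
      then have g': "?g \<in> carrier G" "s \<otimes> ?g = g"
        using g by (simp_all flip: m_assoc)
      then have X': "X \<subseteq> flg False ?g"
        using assms(3)[OF inv g'(1)] g(2) by simp
      \<comment> \<open>A step by an inverse is a generator step from \<open>?g\<close> to
        \<open>g\<close> taken backwards.\<close>
      have "(flg False ?g, flg False (s \<otimes> ?g)) \<in> (flag_step X)\<^sup>*"
        using X' g g' inv S by (intro flag_steps_generator[OF X]) auto
      then show "X \<subseteq> flg False ?g \<and> (flg False g, flg False ?g) \<in> (flag_step X)\<^sup>*"
        using X' g'(2) flag_steps_sym by simp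
    qed
  next
    case (eng h1 h2)
    then have "h1 \<in> carrier G" "h2 \<in> carrier G"
      using generate_in_carrier[OF Sc] by auto
    then show ?case
      using eng.IH by (auto simp: m_assoc intro: rtrancl_trans)
  qed
  then show ?thesis
    using g by blast
qed

lemma strongly_connected_cpos: "strongly_flag_connected cpos"
  unfolding strongly_flag_connected_def flag_step_def[symmetric]
proof (intro ballI)
  fix \<Phi> \<Psi> assume fl: "\<Phi> \<in> flags cpos" "\<Psi> \<in> flags cpos"
  let ?X = "\<Phi> \<inter> \<Psi>"
  obtain e g where g: "g \<in> carrier G" "\<Phi> = flg e g"
    using flags_cpos_cases[OF fl(1)] .
  obtain e' g' where g': "g' \<in> carrier G" "\<Psi> = flg e' g'"
    using flags_cpos_cases[OF fl(2)] .
  define a b c where "a = face 0 g" and "b = face 1 (if e then \<sigma> 1 \<otimes> g else g)" and "c = face 2 g"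
  define a' b' c' where "a' = face 0 g'" and "b' = face 1 (if e' then \<sigma> 1 \<otimes> g' else g')" and "c' = face 2 g'"
  note defs = a_def b_def c_def a'_def b'_def c'_def
  have tr: "R.triple a b c" "R.triple a' b' c'"
    unfolding defs using triple_flg g g' by blast+
  have \<Phi>: "\<Phi> = R.flag a b c" and \<Psi>: "\<Psi> = R.flag a' b' c'"
    using g g' by (auto simp: flg_def defs)
  have X: "F = (-1, carrier G) \<or> F = a \<and> F = a' \<and> fst F = 0 \<or> F = b \<and> F = b' \<and> fst F = 1 \<or>
      F = c \<and> F = c' \<and> fst F = 2 \<or> F = (3, carrier G)" if "F \<in> ?X" for F
    using that R.mem_flag_rank[OF tr(1), of F] R.mem_flag_rank[OF tr(2), of F] unfolding \<Phi> \<Psi> by auto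
  show "(\<Phi>, \<Psi>) \<in> (flag_step ?X)\<^sup>*"
  proof (cases "b = b'")
    case True
    \<comment> \<open>With a common edge, the vertex and then the 2-face can be exchanged without
      losing incidence.\<close>
    have tr': "R.triple a' b c"
      using tr True by (simp add: R.triple_def)
    have X': "?X \<subseteq> R.flag a' b c"
      using X by (auto simp: R.flag_def)
    have "(\<Phi>, R.flag a' b c) \<in> (flag_step ?X)\<^sup>*"
      unfolding \<Phi> by (rule flag_step_two_common[OF tr(1) tr']) (use X' \<Phi> in auto)
    moreover have "(R.flag a' b c, \<Psi>) \<in> (flag_step ?X)\<^sup>*"
      unfolding \<Psi> by (rule flag_step_two_common[OF tr' tr(2)]) (use X' True \<Psi> in auto)
    ultimately show ?thesis by simp
  next
    case b: False
    have X1: "\<forall>F \<in> ?X. fst F \<noteq> 1"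
      using X b by fastforce
    have "(flg False g, flg False g') \<in> (flag_step ?X)\<^sup>*"
    proof -
      have Xg: "?X \<subseteq> flg False g"
        using subset_flg_iff[OF X1] g(2) by blast
      define h where "h = g' \<otimes> inv g"
      have h: "h \<in> carrier G" "g' = h \<otimes> g"
        using g g' by (simp_all add: h_def m_assoc)
      \<comment> \<open>The common faces decide which generators may occur:
        \<open>\<sigma> 2\<close> keeps a common vertex, \<open>\<sigma> 1\<close> a common 2-face,
        and without either both are allowed. In each case \<open>h\<close> lies in the group they
        generate.\<close>
      consider "a = a'" "c = c'" | "a = a'" "c \<noteq> c'" | "a \<noteq> a'" "c = c'" | "a \<noteq> a'" "c \<noteq> c'"
        by blast
      then show ?thesis
      proof cases
        case 1
        then have "g = g'"
          using face_0_2_inj[OF g(1) g'(1)] unfolding defs by blast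
        then show ?thesis by simp
      next
        case 2
        have X2: "\<forall>F \<in> ?X. fst F \<noteq> 2"
          using X 2 by fastforce
        have "h \<in> K 0"
          using 2(1) face_mult_eq_iff[OF h(1) g(1), of 0] h(2) unfolding defs by simp
        then have "h \<in> generate G {\<sigma> 2}"
          by (simp add: face_subgroup_eq)
        moreover have "?X \<subseteq> flg False (s \<otimes> x) \<longleftrightarrow> ?X \<subseteq> flg False x" if "s \<in> {\<sigma> 2}" "x \<in> carrier G" for s x
        proof -
          have "face 2 y \<notin> ?X" for y
            using bspec[OF X2, of "face 2 y"] by auto
          moreover have eq: "face 0 (s \<otimes> x) = face 0 x"
            using that face_s2 by simp
          ultimately show ?thesis
            unfolding subset_flg_iff[OF X1] eq by blast
        qed
        ultimately show ?thesis
          unfolding h(2) using flag_steps_generate[OF X1, of "{\<sigma> 2}" h g] g(1) Xg by blast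
      next
        case 3
        have X2: "\<forall>F \<in> ?X. fst F \<noteq> 0"
          using X 3 by fastforce
        have "h \<in> K 2"
          using 3(2) face_mult_eq_iff[OF h(1) g(1), of 2] h(2) unfolding defs by simp
        then have "h \<in> generate G {\<sigma> 1}"
          by (simp add: face_subgroup_eq)
        moreover have "?X \<subseteq> flg False (s \<otimes> x) \<longleftrightarrow> ?X \<subseteq> flg False x" if "s \<in> {\<sigma> 1}" "x \<in> carrier G" for s x
        proof -
          have "face 0 y \<notin> ?X" for y
            using bspec[OF X2, of "face 0 y"] by auto
          moreover have eq: "face 2 (s \<otimes> x) = face 2 x"
            using that face_s1 by simp
          ultimately show ?thesis
            unfolding subset_flg_iff[OF X1] eq by blast
        qed
        ultimately show ?thesis
          unfolding h(2) using flag_steps_generate[OF X1, of "{\<sigma> 1}" h g] g(1) Xg by blast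
      next
        case 4
        have X2: "\<forall>F \<in> ?X. fst F \<noteq> 0 \<and> fst F \<noteq> 2"
          using X 4 by fastforce
        have "h \<in> generate G {\<sigma> 1, \<sigma> 2}"
          using h(1) carrier_eq by simp
        moreover have "?X \<subseteq> flg False (s \<otimes> x) \<longleftrightarrow> ?X \<subseteq> flg False x" for s x
        proof -
          have "face 0 y \<notin> ?X" "face 2 y \<notin> ?X" for y
            using bspec[OF X2, of "face 0 y"] bspec[OF X2, of "face 2 y"] by auto
          then show ?thesis
            unfolding subset_flg_iff[OF X1] by blast
        qed
        ultimately show ?thesis
          unfolding h(2) using flag_steps_generate[OF X1, of "{\<sigma> 1, \<sigma> 2}" h g] g(1) Xg by blast
      qed
    qed
    moreover have "(\<Phi>, flg False g) \<in> (flag_step ?X)\<^sup>*"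
      unfolding g(2) using g g' by (intro flag_steps_flip) (use X1 in auto)
    moreover have "(flg False g', \<Psi>) \<in> (flag_step ?X)\<^sup>*"
      using flag_steps_sym[OF flag_steps_flip[OF X1 g'(1), of e' False]] g'(2) by auto
    ultimately show ?thesis by (meson rtrancl_trans)
  qed
qed

lemma base_cpos: "base cpos = flg False \<one>"
proof -
  have "{-1..int 3} = {-1, 0, 1, 2, 3}"
    by auto
  then have "base cpos = (\<lambda>j. (j, K j)) ` {-1, 0, 1, 2, 3}"
    by (simp add: coset_poset_def)
  also have "(\<lambda>j. (j, K j)) = (\<lambda>j. face j \<one>)"
    using subgroup.subset[OF subgroup_face_subgroup] by (simp add: face_def)
  finally show ?thesis
    unfolding flg_def R.flag_def using face_improper[of "-1" \<one>] face_improper[of 3 \<one>] by simp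
qed

sublocale Q: polyhedron cpos "(-1, carrier G)" "(3, carrier G)"
proof
  show "abstract_polytope 3 cpos"
    unfolding abstract_polytope_def
  proof (intro conjI)
    show "\<exists>L \<in> faces cpos. rank cpos L = -1 \<and> (\<forall>F \<in> faces cpos. (L, F) \<in> le cpos)"
      using R.least by blast
    show "\<exists>T \<in> faces cpos. rank cpos T = int 3 \<and> (\<forall>F \<in> faces cpos. (F, T) \<in> le cpos)"
      using R.greatest by (intro bexI[of _ "(3, carrier G)"]) auto
    show "\<forall>\<Phi> \<in> flags cpos. card \<Phi> = 3 + 2"
      using card_flags_cpos by simp
    show "base cpos \<in> flags cpos"
      unfolding base_cpos by (rule flg_in_flags) simp
  qed (fact R.ranked diamond_cpos strongly_connected_cpos)+
qed

section \<open>Right multiplication by group elements\<close>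

definition rmul :: "'g \<Rightarrow> int \<times> 'g set \<Rightarrow> int \<times> 'g set" where
  "rmul x = (\<lambda>F \<in> faces cpos. (fst F, snd F #> x))"

lemma rmul_face:
  assumes "j \<in> {-1..3}" "g \<in> carrier G" "x \<in> carrier G"
  shows "rmul x (face j g) = face j (g \<otimes> x)"
  using face_in_faces[OF assms(1,2)] coset_mult_assoc[OF subgroup.subset[OF subgroup_face_subgroup] assms(2,3)]
  by (simp add: rmul_def face_def)

lemma rmul_in_faces:
  assumes "F \<in> faces cpos" "x \<in> carrier G"
  shows "rmul x F \<in> faces cpos"
proof -
  obtain j g where "F = face j g" "j \<in> {-1..3}" "g \<in> carrier G"
    using assms(1) unfolding faces_cpos by blast
  then show ?thesis
    using rmul_face face_in_faces assms(2) by simp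
qed

lemma rmul_rmul:
  assumes "F \<in> faces cpos" "x \<in> carrier G" "y \<in> carrier G"
  shows "rmul y (rmul x F) = rmul (x \<otimes> y) F"
proof -
  obtain j g where "F = face j g" "j \<in> {-1..3}" "g \<in> carrier G"
    using assms(1) unfolding faces_cpos by blast
  then show ?thesis
    using rmul_face assms(2,3) by (simp add: m_assoc)
qed

lemma rmul_one: "F \<in> faces cpos \<Longrightarrow> rmul \<one> F = F"
proof -
  assume "F \<in> faces cpos"
  then obtain j g where "F = face j g" "j \<in> {-1..3}" "g \<in> carrier G"
    unfolding faces_cpos by blast
  then show ?thesis
    using rmul_face by simp
qed

lemma rmul_le:
  assumes "(F, H) \<in> le cpos" "x \<in> carrier G"
  shows "(rmul x F, rmul x H) \<in> le cpos"
proof -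
  obtain i j y where "i \<in> {-1..3}" "j \<in> {-1..3}" "i \<le> j" "y \<in> carrier G" "F = face i y" "H = face j y"
    using assms(1) unfolding le_cpos_iff by blast
  then show ?thesis
    using face_le[of "y \<otimes> x" i j] rmul_face assms(2) by simp
qed

lemma rmul_aut:
  assumes x: "x \<in> carrier G"
  shows "rmul x \<in> carrier (aut_group cpos)"
proof -
  have inv: "rmul (inv x) (rmul x F) = F" "rmul x (rmul (inv x) F) = F" if "F \<in> faces cpos" for F
    using that x rmul_rmul rmul_one by simp_all
  have "bij_betw (rmul x) (faces cpos) (faces cpos)"
    using inv rmul_in_faces x by (intro bij_betw_byWitness[of _ "rmul (inv x)"]) auto
  moreover have "rmul x \<in> extensional (faces cpos)"
    by (simp add: rmul_def)
  moreover have "(F, H) \<in> le cpos \<longleftrightarrow> (rmul x F, rmul x H) \<in> le cpos"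
    if "F \<in> faces cpos" "H \<in> faces cpos" for F H
    using rmul_le[OF _ x, of F H] rmul_le[of "rmul x F" "rmul x H" "inv x"] inv that x by auto
  ultimately show ?thesis
    by (simp add: aut_group_def Bij_def)
qed

text \<open>As the left factor of a product of automorphisms acts first, right multiplication is a
  homomorphism and not an antihomomorphism.\<close>

lemma rmul_hom: "group_hom G (aut_group cpos) rmul"
proof (intro group_hom.intro group_hom_axioms.intro homI)
  show "rmul (x \<otimes> y) = rmul x \<otimes>\<^bsub>aut_group cpos\<^esub> rmul y" if "x \<in> carrier G" "y \<in> carrier G" for x y
  proof
    fix F
    show "rmul (x \<otimes> y) F = (rmul x \<otimes>\<^bsub>aut_group cpos\<^esub> rmul y) F"
    proof (cases "F \<in> faces cpos")
      case True
      then show ?thesis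
        using rmul_rmul that by (simp add: aut_mult_apply)
    next
      case False
      then show ?thesis
        by (simp add: aut_group_def compose_def rmul_def)
    qed
  qed
qed (use rmul_aut group_aut_group is_group in auto)

lemma rmul_flg: "g \<in> carrier G \<Longrightarrow> x \<in> carrier G \<Longrightarrow> rmul x ` flg e g = flg e (g \<otimes> x)"
  unfolding flg_def Q.aut_image_flag[OF rmul_aut] by (simp add: rmul_face m_assoc)

section \<open>Neighbours and parity of flags\<close>

lemma flag_nbr_even:
  assumes g: "g \<in> carrier G"
  shows "flag_nbr cpos (flg False g) 0 = flg True (inv (\<sigma> 1) \<otimes> g)"
    and "flag_nbr cpos (flg False g) 1 = flg True g"
    and "flag_nbr cpos (flg False g) 2 = flg True (\<sigma> 2 \<otimes> g)"
proof -
  \<comment> \<open>With \<open>\<sigma> 1 \<otimes> ?g = g\<close>, the flag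
    \<open>flg True ?g\<close> has the edge of \<open>g\<close>; its 2-face is also that of
    \<open>g\<close>, and only the vertex changes.\<close>
  let ?g = "inv (\<sigma> 1) \<otimes> g"
  have g': "?g \<in> carrier G" "\<sigma> 1 \<otimes> ?g = g" "\<sigma> 2 \<otimes> g \<in> carrier G"
    using g by (simp_all flip: m_assoc)
  have "inv (\<sigma> 1) \<notin> K 0"
  proof
    assume "inv (\<sigma> 1) \<in> K 0"
    then have "\<sigma> 1 \<in> K 0"
      using subgroup.m_inv_closed[OF subgroup_face_subgroup] by fastforce
    then show False
      using K0_inter_K2 s1_in_K2 s1_ne_one by blast
  qed
  then have "face 0 ?g \<noteq> face 0 g"
    using face_mult_eq_iff g by simp
  moreover have "face 2 ?g = face 2 g"
    using face_s1[OF g'(1)] g'(2) by simp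
  ultimately have "R.nbr 0 (flg False g) (flg True ?g)"
    unfolding flg_def R.nbr_flag_iff[OF triple_flg[OF g] triple_flg[OF g'(1)]] using g' by simp
  then show "flag_nbr cpos (flg False g) 0 = flg True ?g"
    by (rule Q.flag_nbr_eq) simp
  have "face 1 (\<sigma> 1 \<otimes> g) \<noteq> face 1 g"
    using face_mult_eq_iff g s1_notin_K1 by simp
  then have "R.nbr 1 (flg False g) (flg True g)"
    unfolding flg_def R.nbr_flag_iff[OF triple_flg[OF g] triple_flg[OF g]] by simp
  then show "flag_nbr cpos (flg False g) 1 = flg True g"
    by (rule Q.flag_nbr_eq) simp
  \<comment> \<open>At \<open>\<sigma> 2 \<otimes> g\<close> the vertex is that of \<open>g\<close>,
    and the odd edge is that of \<open>t \<otimes> g\<close>, hence of \<open>g\<close>; only the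
    2-face changes.\<close>
  have "\<sigma> 2 \<notin> K 2"
    using K0_inter_K2 s2_in_K0 s2_ne_one by blast
  then have "face 2 (\<sigma> 2 \<otimes> g) \<noteq> face 2 g"
    using face_mult_eq_iff g by simp
  then have "R.nbr 2 (flg False g) (flg True (\<sigma> 2 \<otimes> g))"
    unfolding flg_def R.nbr_flag_iff[OF triple_flg[OF g] triple_flg[OF g'(3)]]
    using face_s2[OF g] face_s1_s2[OF g] by simp
  then show "flag_nbr cpos (flg False g) 2 = flg True (\<sigma> 2 \<otimes> g)"
    by (rule Q.flag_nbr_eq) simp
qed

lemma flag_nbr_odd:
  assumes g: "g \<in> carrier G"
  shows "flag_nbr cpos (flg True g) 0 = flg False (\<sigma> 1 \<otimes> g)"
    and "flag_nbr cpos (flg True g) 1 = flg False g"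
    and "flag_nbr cpos (flg True g) 2 = flg False (inv (\<sigma> 2) \<otimes> g)"
proof -
  have eq: "inv (\<sigma> 1) \<otimes> (\<sigma> 1 \<otimes> g) = g" "\<sigma> 2 \<otimes> (inv (\<sigma> 2) \<otimes> g) = g"
    using g by (simp_all flip: m_assoc)
  show "flag_nbr cpos (flg True g) 0 = flg False (\<sigma> 1 \<otimes> g)"
    using Q.flag_nbr_invol[OF flg_in_flags, of "\<sigma> 1 \<otimes> g" 0 False] flag_nbr_even(1)[of "\<sigma> 1 \<otimes> g"] eq(1) g by simp
  show "flag_nbr cpos (flg True g) 1 = flg False g"
    using Q.flag_nbr_invol[OF flg_in_flags, of g 1 False] flag_nbr_even(2)[of g] g by simp
  show "flag_nbr cpos (flg True g) 2 = flg False (inv (\<sigma> 2) \<otimes> g)"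
    using Q.flag_nbr_invol[OF flg_in_flags, of "inv (\<sigma> 2) \<otimes> g" 2 False] flag_nbr_even(3)[of "inv (\<sigma> 2) \<otimes> g"] eq(2) g by simp
qed

lemma flg_eq_iff:
  assumes "g \<in> carrier G" "h \<in> carrier G"
  shows "flg e g = flg e' h \<longleftrightarrow> e = e' \<and> g = h"
proof
  assume "flg e g = flg e' h"
  then have eq: "face 0 g = face 0 h" "face 2 g = face 2 h"
    "face 1 (if e then \<sigma> 1 \<otimes> g else g) = face 1 (if e' then \<sigma> 1 \<otimes> h else h)"
    unfolding flg_def R.flag_eq_iff[OF triple_flg[OF assms(1)] triple_flg[OF assms(2)]] by auto
  have gh: "g = h"
    using face_0_2_inj[OF assms eq(1,2)] .
  moreover have "face 1 (\<sigma> 1 \<otimes> h) \<noteq> face 1 h"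
    using face_mult_eq_iff assms s1_notin_K1 by simp
  ultimately show "e = e' \<and> g = h"
    using eq(3) by (cases e; cases e') auto
qed auto

definition odd_flag :: "(int \<times> 'g set) set \<Rightarrow> bool" where
  "odd_flag \<Phi> \<longleftrightarrow> (\<exists>g \<in> carrier G. \<Phi> = flg True g)"

lemma odd_flag_flg: "g \<in> carrier G \<Longrightarrow> odd_flag (flg e g) \<longleftrightarrow> e"
  using flg_eq_iff by (auto simp: odd_flag_def)

lemma odd_flag_nbr:
  assumes "\<Phi> \<in> flags cpos" "j \<in> {0, 1, 2}"
  shows "odd_flag (flag_nbr cpos \<Phi> j) \<longleftrightarrow> \<not> odd_flag \<Phi>"
proof -
  obtain e g where "g \<in> carrier G" "\<Phi> = flg e g"
    using flags_cpos_cases[OF assms(1)] .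
  then show ?thesis
    using assms(2) by (cases e) (auto simp: flag_nbr_even flag_nbr_odd odd_flag_flg)
qed

text \<open>Adjacency makes the flags a connected bipartite graph and automorphisms respect it, so
  they preserve the parity of all flags or reverse it for all.\<close>

lemma aut_parity:
  assumes \<gamma>: "\<gamma> \<in> carrier (aut_group cpos)" and fl: "\<Phi> \<in> flags cpos" "\<Psi> \<in> flags cpos"
  shows "(odd_flag (\<gamma> ` \<Psi>) \<longleftrightarrow> odd_flag \<Psi>) \<longleftrightarrow> (odd_flag (\<gamma> ` \<Phi>) \<longleftrightarrow> odd_flag \<Phi>)"
  using fl
proof (induction rule: Q.flag_induct)
  case base
  show ?case by simp
next
  case (nbr \<Lambda> j)
  then show ?case
    using odd_flag_nbr[OF nbr(1,2)] odd_flag_nbr[OF Q.aut_image_in_flags[OF \<gamma> nbr(1)] nbr(2)]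
      Q.aut_flag_nbr[OF \<gamma> nbr(1,2)] by simp
qed

text \<open>The rotation group turns out to be the group of right multiplications, which are exactly
  the parity-preserving automorphisms. Transitivity supplies a parity-reversing one, so there are
  two cosets.\<close>

lemma flag_transitive_imp_directly_regular:
  assumes ft: "flag_transitive cpos"
  shows "directly_regular 3 cpos"
proof -
  interpret hom: group_hom G "aut_group cpos" rmul
    by (rule rmul_hom)
  let ?N = "carrier (rotation_group 3 cpos)" and ?B = "base cpos"
  \<comment> \<open>By freeness images of the base flag suffice. Its neighbours lead through
    \<open>flg True \<one>\<close> to \<open>flg False (\<sigma> 1)\<close>, and through
    \<open>flg True (\<sigma> 2)\<close> to \<open>flg False (\<sigma> 2)\<close>.\<close>
  have s: "rot_gen cpos 1 = rmul (\<sigma> 1)" "rot_gen cpos 2 = rmul (\<sigma> 2)"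
  proof -
    note r1 = Q.rot_gen_flag_transitive[OF ft, of 1] and r2 = Q.rot_gen_flag_transitive[OF ft, of 2]
    show "rot_gen cpos 1 = rmul (\<sigma> 1)"
      using r1 rmul_aut Q.base_in_flags
      by (intro Q.aut_eqI[of _ _ ?B])
        (auto simp: base_cpos rmul_flg flag_nbr_even flag_nbr_odd)
    show "rot_gen cpos 2 = rmul (\<sigma> 2)"
      using r2 rmul_aut Q.base_in_flags
      by (intro Q.aut_eqI[of _ _ ?B])
        (auto simp: base_cpos rmul_flg flag_nbr_even flag_nbr_odd)
  qed
  have N: "?N = rmul ` carrier G"
  proof -
    have "{1..int 3 - 1} = {1, 2}" by auto
    then have "rotation_group 3 cpos = subgroup_generated (aut_group cpos) (rmul ` {\<sigma> 1, \<sigma> 2})"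
      using ft s by (simp add: rotation_group_def)
    moreover have "rmul ` {\<sigma> 1, \<sigma> 2} \<subseteq> carrier (aut_group cpos)"
      using rmul_aut by auto
    ultimately have "?N = generate (aut_group cpos) (rmul ` {\<sigma> 1, \<sigma> 2})"
      by (simp only: carrier_subgroup_generated Int_absorb1)
    also have "\<dots> = rmul ` generate G {\<sigma> 1, \<sigma> 2}"
      by (rule hom.generate_img) auto
    finally show ?thesis
      using carrier_eq by simp
  qed
  have sub: "subgroup ?N (aut_group cpos)"
    unfolding N by (rule hom.img_is_subgroup)
  have N_iff: "\<gamma> \<in> ?N \<longleftrightarrow> \<not> odd_flag (\<gamma> ` ?B)" if \<gamma>: "\<gamma> \<in> carrier (aut_group cpos)" for \<gamma>
  proof -
    obtain e g where eg: "g \<in> carrier G" "\<gamma> ` ?B = flg e g"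
      using flags_cpos_cases[OF Q.aut_image_in_flags[OF \<gamma> Q.base_in_flags]] .
    have B: "rmul x ` ?B = flg False x" if "x \<in> carrier G" for x
      using that by (simp add: base_cpos rmul_flg)
    show ?thesis
    proof
      assume "\<gamma> \<in> ?N"
      then obtain x where "x \<in> carrier G" "\<gamma> = rmul x"
        unfolding N by blast
      then show "\<not> odd_flag (\<gamma> ` ?B)"
        using B odd_flag_flg by simp
    next
      assume "\<not> odd_flag (\<gamma> ` ?B)"
      then have "\<gamma> ` ?B = rmul g ` ?B"
        using eg B odd_flag_flg by simp
      then have "\<gamma> = rmul g"
        using Q.aut_eqI[OF \<gamma> rmul_aut[OF eg(1)] Q.base_in_flags] by simp
      then show "\<gamma> \<in> ?N"
        unfolding N using eg(1) by blast
    qed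
  qed
  have evB: "\<not> odd_flag ?B"
    using odd_flag_flg[of \<one> False] by (simp add: base_cpos)
  obtain \<rho> where \<rho>: "\<rho> \<in> carrier (aut_group cpos)" "\<rho> ` ?B = flg True \<one>"
    using ft Q.base_in_flags flg_in_flags[of \<one> True] unfolding flag_transitive_def by blast
  have \<rho>N: "\<rho> \<notin> ?N"
    using N_iff[OF \<rho>(1)] \<rho>(2) odd_flag_flg[of \<one> True] by simp
  have "?N #>\<^bsub>aut_group cpos\<^esub> \<gamma> \<in> {?N, ?N #>\<^bsub>aut_group cpos\<^esub> \<rho>}" if \<gamma>: "\<gamma> \<in> carrier (aut_group cpos)" for \<gamma>
  proof (cases "\<gamma> \<in> ?N")
    case True
    then show ?thesis
      using Q.A.coset_join2[OF \<gamma> sub] by simp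
  next
    case False
    \<comment> \<open>Two parity-reversing automorphisms differ by a parity-preserving one, which
      puts \<open>\<gamma>\<close> into the coset of \<open>\<rho>\<close>.\<close>
    let ?\<delta> = "\<gamma> \<otimes>\<^bsub>aut_group cpos\<^esub> inv\<^bsub>aut_group cpos\<^esub> \<rho>"
    have \<delta>: "?\<delta> \<in> carrier (aut_group cpos)" "inv\<^bsub>aut_group cpos\<^esub> \<rho> \<in> carrier (aut_group cpos)"
      using \<gamma> \<rho> by auto
    note sb = Q.flags_subset_faces[OF Q.base_in_flags]
    have fl: "\<rho> ` ?B \<in> flags cpos" "\<gamma> ` ?B \<in> flags cpos"
      using Q.aut_image_in_flags Q.base_in_flags \<gamma> \<rho>(1) by simp_all
    have "(inv\<^bsub>aut_group cpos\<^esub> \<rho>) ` \<rho> ` ?B = ?B"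
      using aut_mult_image[OF sb, of \<rho> "inv\<^bsub>aut_group cpos\<^esub> \<rho>"] aut_one_image[OF sb] \<rho>(1) by simp
    moreover have "odd_flag (\<rho> ` ?B)" "odd_flag (\<gamma> ` ?B)"
      using N_iff \<gamma> \<rho>(1) \<rho>N False by auto
    ultimately have "\<not> odd_flag ((inv\<^bsub>aut_group cpos\<^esub> \<rho>) ` \<gamma> ` ?B)"
      using aut_parity[OF \<delta>(2) fl] evB by simp
    then have "?\<delta> \<in> ?N"
      using N_iff[OF \<delta>(1)] aut_mult_image[OF sb] by simp
    then have "\<gamma> \<in> ?N #>\<^bsub>aut_group cpos\<^esub> \<rho>"
      using \<gamma> \<rho> by (auto simp: r_coset_def Q.A.m_assoc intro!: bexI[of _ ?\<delta>])
    then have "?N #>\<^bsub>aut_group cpos\<^esub> \<gamma> = ?N #>\<^bsub>aut_group cpos\<^esub> \<rho>"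
      using Q.A.repr_independence[OF _ \<rho>(1) sub] by simp
    then show ?thesis by simp
  qed
  moreover have "?N #>\<^bsub>aut_group cpos\<^esub> \<one>\<^bsub>aut_group cpos\<^esub> = ?N"
    using subgroup.subset[OF sub] by simp
  ultimately have "rcosets\<^bsub>aut_group cpos\<^esub> ?N = {?N, ?N #>\<^bsub>aut_group cpos\<^esub> \<rho>}"
    using \<rho>(1) Q.A.one_closed unfolding RCOSETS_def by blast
  moreover have "?N \<noteq> ?N #>\<^bsub>aut_group cpos\<^esub> \<rho>"
    using \<rho>N Q.A.rcos_self[OF \<rho>(1) sub] by auto
  ultimately have "card (rcosets\<^bsub>aut_group cpos\<^esub> ?N) = 2"
    by simp
  then show ?thesis
    using ft Q.polytope by (simp add: directly_regular_def regular_def)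
qed

text \<open>Right multiplication places each parity class within one orbit. The two orbits are
  distinct, as otherwise all flags would be equivalent, and adjacent flags have opposite
  parity.\<close>

lemma not_flag_transitive_imp_chiral:
  assumes nft: "\<not> flag_transitive cpos"
  shows "chiral 3 cpos"
proof -
  let ?O = "orbit (aut_group cpos) (`)"
  have orb: "?O (flg e g) = ?O (flg e \<one>)" if "g \<in> carrier G" for e g
    using Q.orbit_image[OF rmul_aut[OF that] flg_in_flags[OF one_closed, of e]] rmul_flg[of \<one> g e] that by simp
  have ne: "?O (flg False \<one>) \<noteq> ?O (flg True \<one>)"
  proof
    assume eq: "?O (flg False \<one>) = ?O (flg True \<one>)"
    have "flag_transitive cpos"
      unfolding flag_transitive_def
    proof (intro ballI)
      fix \<Phi> \<Psi> assume fl: "\<Phi> \<in> flags cpos" "\<Psi> \<in> flags cpos"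
      obtain e g where g: "g \<in> carrier G" "\<Phi> = flg e g"
        using flags_cpos_cases[OF fl(1)] .
      obtain e' g' where g': "g' \<in> carrier G" "\<Psi> = flg e' g'"
        using flags_cpos_cases[OF fl(2)] .
      have "?O \<Phi> = ?O \<Psi>"
        unfolding g(2) g'(2) orb[OF g(1)] orb[OF g'(1)] using eq by (cases e; cases e') simp_all
      then have "\<Psi> \<in> ?O \<Phi>"
        using Q.orbit_refl[OF fl(2)] by simp
      then show "\<exists>\<gamma> \<in> carrier (aut_group cpos). \<gamma> ` \<Phi> = \<Psi>"
        by (auto simp: orbit_def)
    qed
    then show False
      using nft by simp
  qed
  have "orbits (aut_group cpos) (flags cpos) (`) = {?O (flg False \<one>), ?O (flg True \<one>)}"
  proof (intro equalityI subsetI)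
    fix X assume "X \<in> orbits (aut_group cpos) (flags cpos) (`)"
    then obtain \<Phi> where "\<Phi> \<in> flags cpos" "X = ?O \<Phi>"
      by (auto simp: orbits_def)
    moreover obtain e g where "g \<in> carrier G" "\<Phi> = flg e g"
      using flags_cpos_cases[OF calculation(1)] .
    ultimately have "X = ?O (flg e \<one>)"
      using orb[of g e] by simp
    then show "X \<in> {?O (flg False \<one>), ?O (flg True \<one>)}"
      by (cases e) simp_all
  next
    fix X assume "X \<in> {?O (flg False \<one>), ?O (flg True \<one>)}"
    then show "X \<in> orbits (aut_group cpos) (flags cpos) (`)"
      using flg_in_flags[OF one_closed] by (auto simp: orbits_def)
  qed
  then have "card (orbits (aut_group cpos) (flags cpos) (`)) = 2"
    using ne by simp
  moreover have "?O \<Phi> \<noteq> ?O \<Psi>" if fl: "\<Phi> \<in> flags cpos" "\<Psi> \<in> flags cpos" and adj: "adjacent \<Phi> \<Psi>" for \<Phi> \<Psi>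
  proof -
    obtain j where "j \<in> {0, 1, 2}" "\<Psi> = flag_nbr cpos \<Phi> j"
      using adj Q.adjacent_iff_flag_nbr[OF fl] by blast
    then have odd: "odd_flag \<Psi> \<longleftrightarrow> \<not> odd_flag \<Phi>"
      using odd_flag_nbr fl(1) by simp
    obtain e g where g: "g \<in> carrier G" "\<Phi> = flg e g"
      using flags_cpos_cases[OF fl(1)] .
    obtain e' g' where g': "g' \<in> carrier G" "\<Psi> = flg e' g'"
      using flags_cpos_cases[OF fl(2)] .
    have "e' \<longleftrightarrow> \<not> e"
      using odd g g' odd_flag_flg by simp
    then show ?thesis
      unfolding g(2) g'(2) orb[OF g(1)] orb[OF g'(1)] using ne by (cases e) auto
  qed
  ultimately show ?thesis
    using Q.polytope unfolding chiral_def by blast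
qed

theorem chiral_or_directly_regular_cpos: "chiral 3 cpos \<or> directly_regular 3 cpos"
  using flag_transitive_imp_directly_regular not_flag_transitive_imp_chiral by blast

end

section \<open>The mix\<close>

text \<open>The projections carry the cyclic group of a pair into the cyclic groups of its
  coordinates, so an element of both cyclic groups is trivial in each coordinate. Nontriviality of a
  pair is visible in its first coordinate.\<close>

lemma rotation_pair_mix:
  assumes A: "rotation_pair A a1 a2" and B: "rotation_pair B b1 b2"
  shows "rotation_pair (subgroup_generated (A \<times>\<times> B) {(a1, b1), (a2, b2)}) (a1, b1) (a2, b2)"
proof -
  interpret A: rotation_pair A a1 a2 by fact
  interpret B: rotation_pair B b1 b2 by fact
  let ?D = "A \<times>\<times> B" and ?S = "{(a1, b1), (a2, b2)}"
  let ?M = "subgroup_generated ?D ?S"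
  interpret D: group ?D
    by (rule DirProd_group) unfold_locales
  have S: "?S \<subseteq> carrier ?D"
    by simp
  have SM: "(a1, b1) \<in> carrier ?M" "(a2, b2) \<in> carrier ?M"
    using D.subgroup_generated_subset_carrier_subset[OF S] by auto
  have gen: "generate ?M {s} = generate ?D {s}" if "s \<in> carrier ?M" for s
    using D.generate_consistent[OF _ D.subgroup_subgroup_generated, of "{s}" ?S] that
    by (simp add: subgroup_generated_def)
  have fst_gen: "fst x \<in> generate A {a}" "snd x \<in> generate B {b}"
    if "x \<in> generate ?D {(a, b)}" "a \<in> carrier A" "b \<in> carrier B" for x a b
    using that(1)
    by (induction rule: generate.induct)
      (auto simp: that inv_DirProd[OF A.is_group B.is_group] intro: generate.intros)
  show ?thesis
  proof (intro rotation_pair.intro rotation_pair_axioms.intro)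
    show "group ?M"
      by simp
    show "(a1, b1) \<in> carrier ?M" "(a2, b2) \<in> carrier ?M"
      by (fact SM)+
    show "(a1, b1) \<otimes>\<^bsub>?M\<^esub> (a2, b2) \<otimes>\<^bsub>?M\<^esub> ((a1, b1) \<otimes>\<^bsub>?M\<^esub> (a2, b2)) = \<one>\<^bsub>?M\<^esub>"
      using A.s1_s2_invol B.s1_s2_invol by simp
    show "(a1, b1) \<noteq> \<one>\<^bsub>?M\<^esub>" "(a2, b2) \<noteq> \<one>\<^bsub>?M\<^esub>"
      using A.s1_ne_one A.s2_ne_one by auto
    show "generate ?M {(a1, b1)} \<inter> generate ?M {(a2, b2)} \<subseteq> {\<one>\<^bsub>?M\<^esub>}"
    proof
      fix x assume "x \<in> generate ?M {(a1, b1)} \<inter> generate ?M {(a2, b2)}"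
      then have x: "x \<in> generate ?D {(a1, b1)}" "x \<in> generate ?D {(a2, b2)}"
        using gen SM by auto
      then have "fst x = \<one>\<^bsub>A\<^esub>" "snd x = \<one>\<^bsub>B\<^esub>"
        using fst_gen[OF x(1)] fst_gen[OF x(2)] A.generate_inter B.generate_inter by auto
      then show "x \<in> {\<one>\<^bsub>?M\<^esub>}"
        by (simp add: prod_eq_iff)
    qed
  qed
qed

lemma rotation_pair_polyhedron:
  assumes "chiral 3 P \<or> directly_regular 3 P"
  shows "rotation_pair (rotation_group 3 P) (rot_gen P 1) (rot_gen P 2)"
proof -
  have ap: "abstract_polytope 3 P"
    using assms by (auto simp: chiral_def directly_regular_def regular_def)
  then obtain L T where "L \<in> faces P" "rank P L = -1" "\<forall>F \<in> faces P. (L, F) \<in> le P"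
    "T \<in> faces P" "rank P T = int 3" "\<forall>F \<in> faces P. (F, T) \<in> le P"
    unfolding abstract_polytope_def by blast
  then have "polyhedron P L T"
    using ap by unfold_locales (auto simp: abstract_polytope_def)
  then show ?thesis
    using assms by (rule polyhedron.rotation_pair_rotation_group)
qed

theorem corollary3p7:
  fixes P :: "'a based_poset" and Q :: "'b based_poset"
  assumes "chiral 3 P \<or> directly_regular 3 P"
    and "chiral 3 Q \<or> directly_regular 3 Q"
  shows "chiral 3 (mix 3 P Q) \<or> directly_regular 3 (mix 3 P Q)"
proof -
  let ?D = "rotation_group 3 P \<times>\<times> rotation_group 3 Q" and ?g = "mix_gen P Q"
  have "{1..int 3 - 1} = {1, 2}"
    by auto
  then have M: "mix_group 3 P Q = subgroup_generated ?D {?g 1, ?g 2}"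
    by (simp add: mix_group_def)
  interpret P: rotation_pair "rotation_group 3 P" "rot_gen P 1" "rot_gen P 2"
    using assms(1) by (rule rotation_pair_polyhedron)
  interpret Q: rotation_pair "rotation_group 3 Q" "rot_gen Q 1" "rot_gen Q 2"
    using assms(2) by (rule rotation_pair_polyhedron)
  interpret D: group ?D
    by (rule DirProd_group) unfold_locales
  have rp: "rotation_pair (mix_group 3 P Q) (?g 1) (?g 2)"
    unfolding M mix_gen_def by (rule rotation_pair_mix) unfold_locales
  have S: "{?g 1, ?g 2} \<subseteq> carrier ?D"
    by (simp add: mix_gen_def)
  have "carrier (mix_group 3 P Q) = generate ?D {?g 1, ?g 2}"
    unfolding M carrier_subgroup_generated using S by (simp only: Int_absorb1)
  \<comment> \<open>The carrier arises by generation inside the direct product, whereas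
    \<open>rotation_pair_poset\<close> asks for generation inside the mix itself.\<close>
  also have "\<dots> = generate (mix_group 3 P Q) {?g 1, ?g 2}"
  proof -
    have "{?g 1, ?g 2} \<subseteq> generate ?D {?g 1, ?g 2}"
      by (auto intro: generate.incl)
    then have "generate (?D\<lparr>carrier := generate ?D {?g 1, ?g 2}\<rparr>) {?g 1, ?g 2} = generate ?D {?g 1, ?g 2}"
      using S by (intro D.generate_consistent D.generate_is_subgroup)
    moreover have "mix_group 3 P Q = ?D\<lparr>carrier := generate ?D {?g 1, ?g 2}\<rparr>"
      unfolding M subgroup_generated_def using S by (simp only: Int_absorb1)
    ultimately show ?thesis by simp
  qed
  finally have "rotation_pair_poset (mix_group 3 P Q) ?g"
    using rp by (intro rotation_pair_poset.intro rotation_pair_poset_axioms.intro)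
  then show ?thesis
    unfolding mix_def by (rule rotation_pair_poset.chiral_or_directly_regular_cpos)
qed

end
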